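(* Let $\mathbf F$ be a finite field with $q$ elements, and let $P_1$ and $P_2$ be projective spaces over $\mathbf F$ of dimension $n>3$. Let $f:P_1\to P_2$ be an injection of sets (of $\mathbf F$-points). Assume given $\epsilon>0$ such that the proportion of lines $L\subset P_1$ for which $f(L)\subset P_2$ is a line is at least $1-\epsilon$, and assume that $$A(q,n,\epsilon)+2\frac{q^2(q+1)^2}{q^{n+1}-1}<\frac12$$ and $$9B(q,n,\epsilon)+q^{-n+3}<1.$$ Then there is an injection $f':P_1\to P_2$ that takes lines to lines, and such that the proportion of elements of $P_1$ on which $f$ and $f'$ agree is at least $$1-2\epsilon-2A(q,n,\epsilon)-2\frac{q^2(q+1)^2}{q^{n+1}-q}.$$
   Context: The functions $A$ and $B$ are $$A(q,n,\epsilon):=2\left(\epsilon+\frac{q-1}{q^{n+1}-1}\right)\cdot\left(\frac{q^{n+1}-q}{q^{n+1}-1}\right)^{-2}+\frac{(q-1)^2}{q^{n+1}-q},$$ $$B(q,n,\epsilon):=2(q-1)\cdot\frac{q^{n+1}-1}{q^{n+1}-q}\cdot\left(2\epsilon+2A(q,n,\epsilon)+2\frac{q^2(q+1)^2}{q^{n+1}-q}\right)+2A(q,n,\epsilon)+2\frac{q^2(q+1)^2}{q^{n+1}-q}.$$ The proportion of elements of a finite set $S$ having a property is the number of such elements divided by $\#S$. *)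

theory Defs
  imports Complex_Main
begin

text \<open>
  The projective space of one-dimensional subspaces of a vector space with scalar multiplication
  \<open>scale\<close>, of projective dimension \<open>n\<close> when the vector space has dimension \<open>n + 1\<close>.
  A line is represented by its set of rational points.
\<close>

definition proj_points :: "('a::field \<Rightarrow> 'b::ab_group_add \<Rightarrow> 'b) \<Rightarrow> 'b set set" where
  "proj_points scale = {p. module.subspace scale p \<and> vector_space.dim scale p = 1}"

definition proj_lines :: "('a::field \<Rightarrow> 'b::ab_group_add \<Rightarrow> 'b) \<Rightarrow> 'b set set set" where
  "proj_lines scale =
     {{p \<in> proj_points scale. p \<subseteq> W} | W. module.subspace scale W \<and> vector_space.dim scale W = 2}"

definition proportion :: "'x set \<Rightarrow> ('x \<Rightarrow> bool) \<Rightarrow> real" where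
  "proportion S P = real (card {x \<in> S. P x}) / real (card S)"

definition bound_A :: "nat \<Rightarrow> nat \<Rightarrow> real \<Rightarrow> real" where
  "bound_A q n \<epsilon> =
     2 * (\<epsilon> + (real q - 1) / (real q ^ (n + 1) - 1))
       * ((real q ^ (n + 1) - real q) / (real q ^ (n + 1) - 1)) powi (-2)
     + (real q - 1)^2 / (real q ^ (n + 1) - real q)"

definition bound_B :: "nat \<Rightarrow> nat \<Rightarrow> real \<Rightarrow> real" where
  "bound_B q n \<epsilon> =
     2 * (real q - 1) * ((real q ^ (n + 1) - 1) / (real q ^ (n + 1) - real q))
       * (2 * \<epsilon> + 2 * bound_A q n \<epsilon>
          + 2 * ((real q)^2 * (real q + 1)^2 / (real q ^ (n + 1) - real q)))
     + 2 * bound_A q n \<epsilon>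
     + 2 * ((real q)^2 * (real q + 1)^2 / (real q ^ (n + 1) - real q))"

end

theory Submission
  imports Defs
begin

text \<open>
  Call a line of the source good if \<open>f\<close> maps it onto a line. The map \<open>f'\<close> is built by letting the
  lines through a point vote on its image. Fix a point \<open>p\<close> and consider the ordered pairs
  \<open>(a, a')\<close> of distinct points, both different from \<open>p\<close>, that are collinear with \<open>p\<close>. Two such pairs
  \<open>(a, a')\<close> and \<open>(b, b')\<close> lie in a plane, so the lines \<open>ab\<close> and \<open>a'b'\<close> have a common point \<open>c\<close>; if
  both are good, then \<open>f c\<close> is common to their images, and therefore the lines \<open>f a f a'\<close> and
  \<open>f b f b'\<close> meet as well. A random pair of points spans a good line with probability close to
  \<open>1\<close>, so almost any two of the lines \<open>f a f a'\<close> meet (\<open>few_nonmeeting\<close>); the first summand of the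
  quantity \<open>A\<close> bounds the proportion of exceptions. This holds for every \<open>p\<close>, however bad the lines through \<open>p\<close> are.

  Lines that pairwise meet are concurrent or coplanar, and by injectivity of \<open>f\<close> few of the lines
  \<open>f a f a'\<close> can lie in one plane. Hence nine tenths of them pass through a common point, the
  centre \<open>f' p\<close> (\<open>centre_exists\<close>).

  For collinear points \<open>p\<^sub>1, p\<^sub>2, p\<^sub>3\<close> take a random triangle \<open>a\<^sub>1 a\<^sub>2 a\<^sub>3\<close> whose sides pass through
  them. With positive probability each line \<open>f a\<^sub>i f a\<^sub>j\<close> passes through the corresponding centre. If
  the three centres were not collinear, \<open>f a\<^sub>1\<close> would then lie in the plane they span, which is too
  small to contain it for most choices (\<open>centre_collinear\<close>). Two points with the same centre \<open>r\<close> would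
  send, for some \<open>a\<close>, more than \<open>q - 1\<close> points into the \<open>q - 1\<close> places of the line \<open>r f a\<close> other
  than \<open>r\<close> and \<open>f a\<close> (\<open>centre_inj\<close>). Finally, if \<open>f p \<noteq> f' p\<close>, a good line through \<open>p\<close> can vote for
  \<open>f' p\<close> only if its image is the one line joining \<open>f p\<close> to \<open>f' p\<close>; so at least half of the lines
  through \<open>p\<close> are bad, and by averaging at most a proportion \<open>2\<epsilon>\<close> of the points has this property
  (\<open>card_moved_points\<close>).

  The argument is synthetic: it uses only that two points span a unique line, that coplanar lines
  meet, and that all lines have \<open>q + 1\<close> points. The hypothesis \<open>9B + q\<^sup>3\<^sup>-\<^sup>n < 1\<close> enters through the
  consequence \<open>54 (A + Q) < 1\<close>, where \<open>Q = q\<^sup>2 (q + 1)\<^sup>2 / (q\<^sup>n\<^sup>+\<^sup>1 - q)\<close>: smallness of \<open>A\<close> says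
  that bad pairs of points are rare, and smallness of \<open>Q\<close> that \<open>(q + 1)\<^sup>3\<close>, a bound for the number of
  points of a plane, is small against the number of all points.
\<close>

section \<open>Projective geometries of finite order\<close>

definition collinear :: "'p set set \<Rightarrow> 'p \<Rightarrow> 'p \<Rightarrow> 'p \<Rightarrow> bool" where
  "collinear lines a b c \<longleftrightarrow> (\<exists>L\<in>lines. a \<in> L \<and> b \<in> L \<and> c \<in> L)"

lemma collinear_perms:
  "collinear lines a b c \<longleftrightarrow> collinear lines b a c"
  "collinear lines a b c \<longleftrightarrow> collinear lines a c b"
  unfolding collinear_def by blast+

lemma averaging:
  fixes g :: "'x \<Rightarrow> nat"
  assumes "finite A" "A \<noteq> {}" "(\<Sum>x\<in>A. g x) \<le> c * card A"
  obtains x where "x \<in> A" "g x \<le> c"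
proof (rule ccontr)
  assume "\<not> thesis"
  then have "\<And>x. x \<in> A \<Longrightarrow> c < g x"
    using that by (meson not_le)
  then have "(\<Sum>x\<in>A. c) < (\<Sum>x\<in>A. g x)"
    using assms by (intro sum_strict_mono) auto
  then show False using assms by (simp add: mult.commute)
qed

lemma card_pairs_eq_sum:
  assumes "finite A" "finite B"
  shows "card {(x, y). x \<in> A \<and> y \<in> B \<and> R x y} = (\<Sum>x\<in>A. card {y\<in>B. R x y})"
proof -
  have "{(x, y). x \<in> A \<and> y \<in> B \<and> R x y} = Sigma A (\<lambda>x. {y\<in>B. R x y})" by auto
  then show ?thesis using assms by (simp add: card_SigmaI)
qed

text \<open>
  Veblen's axiom in the form: if the lines \<open>ab\<close> and \<open>cd\<close> meet, then so do \<open>ac\<close> and \<open>bd\<close>. Coincidences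
  among the points are allowed; they make the conclusion trivial, and admitting them spares case
  distinctions in every application.
\<close>

locale projective_geometry =
  fixes P :: "'p set" and lines :: "'p set set" and q :: nat
  assumes finite_points: "finite P"
    and order_ge_2: "2 \<le> q"
    and line_subset: "L \<in> lines \<Longrightarrow> L \<subseteq> P"
    and card_line: "L \<in> lines \<Longrightarrow> card L = Suc q"
    and ex1_line: "a \<in> P \<Longrightarrow> b \<in> P \<Longrightarrow> a \<noteq> b \<Longrightarrow> \<exists>!L. L \<in> lines \<and> a \<in> L \<and> b \<in> L"
    and Veblen: "collinear lines a b x \<Longrightarrow> collinear lines c d x \<Longrightarrow>
      \<exists>y. collinear lines a c y \<and> collinear lines b d y"
begin

abbreviation col :: "'p \<Rightarrow> 'p \<Rightarrow> 'p \<Rightarrow> bool" where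
  "col \<equiv> collinear lines"

definition line :: "'p \<Rightarrow> 'p \<Rightarrow> 'p set" where
  "line a b = (THE L. L \<in> lines \<and> a \<in> L \<and> b \<in> L)"

lemma line:
  assumes "a \<in> P" "b \<in> P" "a \<noteq> b"
  shows line_in_lines: "line a b \<in> lines" and line_left: "a \<in> line a b"
    and line_right: "b \<in> line a b"
  using theI'[OF ex1_line[OF assms]] unfolding line_def by auto

lemma finite_line: "L \<in> lines \<Longrightarrow> finite L"
  using line_subset finite_points finite_subset by blast

lemma line_eqI:
  assumes "L \<in> lines" "a \<in> L" "b \<in> L" "a \<noteq> b"
  shows "line a b = L"
  using ex1_line[of a b] line[of a b] assms line_subset by blast

lemma lines_meet_once:
  assumes "L \<in> lines" "M \<in> lines" "L \<noteq> M" "x \<in> L" "x \<in> M" "y \<in> L" "y \<in> M"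
  shows "x = y"
  using assms line_eqI by metis

lemma col_points: "col a b c \<Longrightarrow> a \<in> P \<and> b \<in> P \<and> c \<in> P"
  unfolding collinear_def using line_subset by blast

lemma col_iff_mem_line:
  assumes "a \<in> P" "b \<in> P" "a \<noteq> b"
  shows "col a b c \<longleftrightarrow> c \<in> line a b"
  using line[OF assms] line_eqI[of _ a b] assms(3) unfolding collinear_def by metis

text \<open>
  The sample space at \<open>p\<close>: a uniformly random line through \<open>p\<close> with two distinct points other than \<open>p\<close>
  on it.
\<close>

definition pairs_through :: "'p \<Rightarrow> ('p \<times> 'p) set" where
  "pairs_through p = (SIGMA a:P - {p}. line p a - {p, a})"

lemma pairs_through_iff:
  assumes "p \<in> P"
  shows "(a, b) \<in> pairs_through p \<longleftrightarrow> a \<noteq> p \<and> b \<noteq> p \<and> a \<noteq> b \<and> col p a b"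
  using assms col_iff_mem_line[of p a b] col_points[of p a b]
  unfolding pairs_through_def by auto

lemma pairs_through_swap:
  assumes "p \<in> P"
  shows "prod.swap x \<in> pairs_through p \<longleftrightarrow> x \<in> pairs_through p"
  using assms collinear_perms(2)[of lines p "fst x" "snd x"]
  by (cases x) (auto simp: pairs_through_iff)

lemma pairs_through_points:
  assumes "p \<in> P" "(a, b) \<in> pairs_through p"
  shows "a \<in> P" "b \<in> P"
  using assms col_points by (auto simp: pairs_through_iff)

lemma finite_pairs_through: "p \<in> P \<Longrightarrow> finite (pairs_through p)"
  unfolding pairs_through_def using finite_points finite_line line_in_lines
  by (intro finite_SigmaI) (auto simp: eq_commute)

lemma card_rest_of_line:
  assumes "p \<in> P" "a \<in> P" "a \<noteq> p"
  shows "card (line p a - {p, a}) = q - 1"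
proof -
  have "card (line p a - {p, a}) = card (line p a) - card {p, a}"
    using line[of p a] assms by (intro card_Diff_subset) auto
  then show ?thesis using line_in_lines[of p a] assms by (simp add: card_line)
qed

lemma card_pairs_through_fst_in:
  assumes "p \<in> P" "S \<subseteq> P - {p}"
  shows "card {x \<in> pairs_through p. fst x \<in> S} = card S * (q - 1)"
proof -
  have "{x \<in> pairs_through p. fst x \<in> S} = (SIGMA a:S. line p a - {p, a})"
    using assms(2) unfolding pairs_through_def by auto
  moreover have "finite S" using assms finite_points finite_subset by blast
  moreover have "finite (line p a - {p, a})" "card (line p a - {p, a}) = q - 1" if "a \<in> S" for a
    using that assms card_rest_of_line[of p a] finite_line[OF line_in_lines[of p a]] by auto
  ultimately show ?thesis by (simp add: card_SigmaI)
qed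

lemma card_pairs_through:
  assumes "p \<in> P"
  shows "card (pairs_through p) = (card P - 1) * (q - 1)"
proof -
  have "{x \<in> pairs_through p. fst x \<in> P - {p}} = pairs_through p"
    unfolding pairs_through_def by auto
  then show ?thesis
    using card_pairs_through_fst_in[of p "P - {p}"] assms finite_points by simp
qed

lemma card_pairs_through_fst_le:
  assumes "p \<in> P" "card (S \<inter> P) \<le> k"
  shows "card {x \<in> pairs_through p. fst x \<in> S} \<le> k * (q - 1)"
proof -
  have "{x \<in> pairs_through p. fst x \<in> S} = {x \<in> pairs_through p. fst x \<in> S \<inter> P - {p}}"
    unfolding pairs_through_def by auto
  moreover have "card (S \<inter> P - {p}) \<le> k"
    using assms(2) finite_points by (meson Diff_subset card_mono finite_Int le_trans)
  moreover have "S \<inter> P - {p} \<subseteq> P - {p}" by blast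
  ultimately show ?thesis using card_pairs_through_fst_in[OF assms(1)] by (simp only: mult_le_mono1)
qed

lemma card_pairs_through_snd_le:
  assumes "p \<in> P" "card (S \<inter> P) \<le> k"
  shows "card {x \<in> pairs_through p. snd x \<in> S} \<le> k * (q - 1)"
proof -
  have "{x \<in> pairs_through p. snd x \<in> S} = prod.swap ` {x \<in> pairs_through p. fst x \<in> S}"
  proof
    show "{x \<in> pairs_through p. snd x \<in> S} \<subseteq> prod.swap ` {x \<in> pairs_through p. fst x \<in> S}"
    proof
      fix x assume "x \<in> {x \<in> pairs_through p. snd x \<in> S}"
      then have "prod.swap x \<in> {x \<in> pairs_through p. fst x \<in> S}"
        using pairs_through_swap[OF assms(1), of x] by simp
      then show "x \<in> prod.swap ` {x \<in> pairs_through p. fst x \<in> S}"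
        by (metis imageI swap_swap)
    qed
  qed (use pairs_through_swap[OF assms(1)] in auto)
  then show ?thesis
    using card_pairs_through_fst_le[OF assms]
    by (simp add: card_image)
qed

lemma card_union_lines_le:
  assumes "finite I" "\<And>i. i \<in> I \<Longrightarrow> M i \<in> lines"
  shows "card (\<Union>i\<in>I. M i) \<le> card I * (q + 1)"
proof -
  have "card (\<Union>i\<in>I. M i) \<le> (\<Sum>i\<in>I. card (M i))" using assms(1) by (rule card_UN_le)
  then show ?thesis using assms(2) by (simp add: card_line)
qed

text \<open>
  The cube is the common bound under which lines and planes count as small sets below.
\<close>

lemma card_line_le_cube: "L \<in> lines \<Longrightarrow> card L \<le> (q + 1) ^ 3"
  using self_le_power[of "q + 1" 3] by (simp add: card_line)

lemma card_pairs_on_lines: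
  assumes "B \<subseteq> lines"
  shows "card {(a, b). a \<in> P \<and> b \<in> P \<and> a \<noteq> b \<and> line a b \<in> B} = card B * ((q + 1) * q)"
proof -
  let ?D = "\<lambda>L. SIGMA a:L. L - {a}"
  have eq: "{(a, b). a \<in> P \<and> b \<in> P \<and> a \<noteq> b \<and> line a b \<in> B} = (\<Union>L\<in>B. ?D L)"
  proof (intro set_eqI iffI)
    fix x assume "x \<in> {(a, b). a \<in> P \<and> b \<in> P \<and> a \<noteq> b \<and> line a b \<in> B}"
    then obtain a b where *: "x = (a, b)" "a \<in> P" "b \<in> P" "a \<noteq> b" "line a b \<in> B" by auto
    then have "x \<in> ?D (line a b)" using line_left[of a b] line_right[of a b] by simp
    then show "x \<in> (\<Union>L\<in>B. ?D L)" using * by blast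
  next
    fix x assume "x \<in> (\<Union>L\<in>B. ?D L)"
    then obtain L a b where *: "x = (a, b)" "L \<in> B" "a \<in> L" "b \<in> L" "a \<noteq> b" by blast
    then have "L \<in> lines" using assms by blast
    then have "line a b = L" "a \<in> P" "b \<in> P" using * line_eqI line_subset by blast+
    then show "x \<in> {(a, b). a \<in> P \<and> b \<in> P \<and> a \<noteq> b \<and> line a b \<in> B}" using * by simp
  qed
  have "lines \<subseteq> Pow P" using line_subset by blast
  then have finB: "finite B"
    using assms finite_points by (meson finite_Pow_iff finite_subset)
  have card_D: "finite (?D L)" "card (?D L) = (q + 1) * q" if "L \<in> B" for L
  proof -
    have L: "finite L" "card L = q + 1" using that assms finite_line card_line by auto
    then show "finite (?D L)" by blast
    show "card (?D L) = (q + 1) * q" using L by (subst card_SigmaI) auto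
  qed
  have "card (\<Union>L\<in>B. ?D L) = (\<Sum>L\<in>B. card (?D L))"
  proof (rule card_UN_disjoint[OF finB])
    show "\<forall>L\<in>B. \<forall>M\<in>B. L \<noteq> M \<longrightarrow> ?D L \<inter> ?D M = {}"
      using lines_meet_once assms by blast
  qed (use card_D in blast)
  then show ?thesis using card_D by (simp add: eq)
qed

lemma card_points_and_lines: "card P * (card P - 1) = card lines * ((q + 1) * q)"
proof -
  have "{(a, b). a \<in> P \<and> b \<in> P \<and> a \<noteq> b \<and> line a b \<in> lines} = (SIGMA a:P. P - {a})"
    using line_in_lines by auto
  then show ?thesis using card_pairs_on_lines[OF subset_refl] finite_points by (simp add: card_SigmaI)
qed

text \<open>
  A triangle with sides through three collinear points is determined by the side through
  \<open>p\<^sub>3\<close>: Veblen's axiom makes \<open>a\<^sub>1 p\<^sub>2\<close> and \<open>a\<^sub>2 p\<^sub>1\<close> meet. Thus a pair at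
  \<open>p\<^sub>3\<close> gives rise to pairs at \<open>p\<^sub>2\<close> and \<open>p\<^sub>1\<close>.
\<close>

lemma third_vertex:
  assumes L: "L \<in> lines" "p\<^sub>1 \<in> L" "p\<^sub>2 \<in> L" "p\<^sub>3 \<in> L" "p\<^sub>1 \<noteq> p\<^sub>2" "p\<^sub>1 \<noteq> p\<^sub>3" "p\<^sub>2 \<noteq> p\<^sub>3"
    and a: "(a\<^sub>1, a\<^sub>2) \<in> pairs_through p\<^sub>3" "a\<^sub>1 \<notin> L"
  obtains a\<^sub>3 where "(a\<^sub>1, a\<^sub>3) \<in> pairs_through p\<^sub>2" "(a\<^sub>2, a\<^sub>3) \<in> pairs_through p\<^sub>1"
proof -
  have P: "p\<^sub>1 \<in> P" "p\<^sub>2 \<in> P" "p\<^sub>3 \<in> P" using L line_subset by blast+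
  obtain M where M: "M \<in> lines" "p\<^sub>3 \<in> M" "a\<^sub>1 \<in> M" "a\<^sub>2 \<in> M" and ne: "a\<^sub>2 \<noteq> p\<^sub>3" "a\<^sub>1 \<noteq> a\<^sub>2"
    using a(1) P by (auto simp: pairs_through_iff collinear_def)
  have LM: "L \<noteq> M" using a(2) M by blast
  have a2: "a\<^sub>2 \<notin> L" using lines_meet_once[OF L(1) M(1) LM] L M ne by blast
  have "col a\<^sub>1 a\<^sub>2 p\<^sub>3" "col p\<^sub>2 p\<^sub>1 p\<^sub>3" using L M by (auto simp: collinear_def)
  from Veblen[OF this] obtain a\<^sub>3 where "col a\<^sub>1 p\<^sub>2 a\<^sub>3" "col a\<^sub>2 p\<^sub>1 a\<^sub>3" by blast
  then obtain K J where K: "K \<in> lines" "a\<^sub>1 \<in> K" "p\<^sub>2 \<in> K" "a\<^sub>3 \<in> K"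
    and J: "J \<in> lines" "a\<^sub>2 \<in> J" "p\<^sub>1 \<in> J" "a\<^sub>3 \<in> J" by (auto simp: collinear_def)
  have "p\<^sub>2 \<notin> M" "p\<^sub>1 \<notin> M" using lines_meet_once[OF L(1) M(1) LM] L M by blast+
  moreover have "K \<noteq> L" "J \<noteq> L" using K J a a2 by blast+
  ultimately have "a\<^sub>3 \<noteq> a\<^sub>1" "a\<^sub>3 \<noteq> p\<^sub>2" "a\<^sub>3 \<noteq> a\<^sub>2" "a\<^sub>3 \<noteq> p\<^sub>1"
    using lines_meet_once[OF K(1) M(1), of a\<^sub>1 a\<^sub>2] lines_meet_once[OF J(1) M(1), of a\<^sub>1 a\<^sub>2]
      lines_meet_once[OF K(1) L(1), of p\<^sub>1 p\<^sub>2] lines_meet_once[OF J(1) L(1), of p\<^sub>1 p\<^sub>2]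
      K J L M ne by blast+
  then show ?thesis
    using that[of a\<^sub>3] K J L a a2 P by (auto simp: pairs_through_iff collinear_def)
qed

text \<open>
  The lines \<open>p\<^sub>2 a\<^sub>1\<close> and \<open>p\<^sub>1 a\<^sub>2\<close> are distinct because \<open>a\<^sub>1\<close> lies off \<open>L\<close>. Applied to each side in turn,
  this makes the passage from a triangle to any one of its sides injective.
\<close>

lemma third_vertex_unique:
  assumes L: "L \<in> lines" "p\<^sub>1 \<in> L" "p\<^sub>2 \<in> L" "p\<^sub>1 \<noteq> p\<^sub>2"
    and a: "a\<^sub>1 \<notin> L" "(a\<^sub>1, x) \<in> pairs_through p\<^sub>2" "(a\<^sub>2, x) \<in> pairs_through p\<^sub>1"
      "(a\<^sub>1, y) \<in> pairs_through p\<^sub>2" "(a\<^sub>2, y) \<in> pairs_through p\<^sub>1"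
  shows "x = y"
proof -
  have P: "p\<^sub>1 \<in> P" "p\<^sub>2 \<in> P" "a\<^sub>1 \<in> P" "a\<^sub>2 \<in> P"
    using L line_subset a pairs_through_points by blast+
  have ne: "p\<^sub>2 \<noteq> a\<^sub>1" "p\<^sub>1 \<noteq> a\<^sub>2" using a P by (auto simp: pairs_through_iff)
  note K = line[OF P(2,3) ne(1)] and J = line[OF P(1,4) ne(2)]
  have "x \<in> line p\<^sub>2 a\<^sub>1" "y \<in> line p\<^sub>2 a\<^sub>1" "x \<in> line p\<^sub>1 a\<^sub>2" "y \<in> line p\<^sub>1 a\<^sub>2"
    using a P ne by (auto simp: pairs_through_iff col_iff_mem_line)
  moreover have "line p\<^sub>2 a\<^sub>1 \<noteq> line p\<^sub>1 a\<^sub>2"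
    using K J L a(1) line_eqI[of _ p\<^sub>1 p\<^sub>2] by metis
  ultimately show ?thesis using lines_meet_once[OF K(1) J(1)] by blast
qed

text \<open>
  The plane of \<open>r\<^sub>1, r\<^sub>2, r\<^sub>3\<close> is the union of the lines joining \<open>r\<^sub>3\<close> to the points of \<open>r\<^sub>1 r\<^sub>2\<close>. By
  Veblen's axiom at the vertex \<open>a\<^sub>3\<close> the line \<open>r\<^sub>1 r\<^sub>2\<close> meets \<open>a\<^sub>1 a\<^sub>2\<close> in a point \<open>s\<close>, and then the
  line \<open>s r\<^sub>3\<close> is \<open>a\<^sub>1 a\<^sub>2\<close>.
\<close>

lemma vertex_in_plane_of_points_on_sides:
  assumes "a\<^sub>1 \<in> P" "a\<^sub>2 \<in> P" "a\<^sub>3 \<in> P" "a\<^sub>1 \<noteq> a\<^sub>2" "a\<^sub>1 \<noteq> a\<^sub>3" "a\<^sub>2 \<noteq> a\<^sub>3"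
    and "r\<^sub>3 \<in> line a\<^sub>1 a\<^sub>2" "r\<^sub>2 \<in> line a\<^sub>1 a\<^sub>3" "r\<^sub>1 \<in> line a\<^sub>2 a\<^sub>3" "r\<^sub>1 \<noteq> r\<^sub>2" "r\<^sub>3 \<notin> line r\<^sub>1 r\<^sub>2"
  obtains s where "s \<in> line r\<^sub>1 r\<^sub>2" "a\<^sub>1 \<in> line s r\<^sub>3"
proof -
  note l12 = line[OF assms(1,2,4)] and l13 = line[OF assms(1,3,5)] and l23 = line[OF assms(2,3,6)]
  have r: "r\<^sub>1 \<in> P" "r\<^sub>2 \<in> P" using l13 l23 assms line_subset by blast+
  have "col r\<^sub>1 a\<^sub>2 a\<^sub>3" "col r\<^sub>2 a\<^sub>1 a\<^sub>3" using l13 l23 assms by (auto simp: collinear_def)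
  from Veblen[OF this] obtain s where "col r\<^sub>1 r\<^sub>2 s" "col a\<^sub>1 a\<^sub>2 s"
    using collinear_perms(1) by metis
  then have s: "s \<in> line r\<^sub>1 r\<^sub>2" "s \<in> line a\<^sub>1 a\<^sub>2" using assms r col_iff_mem_line by blast+
  then have "s \<noteq> r\<^sub>3" using assms by blast
  then have "line s r\<^sub>3 = line a\<^sub>1 a\<^sub>2" using line_eqI[OF l12(1)] s assms by blast
  then show ?thesis using that s l12 by simp
qed

end

section \<open>The centre of the images of the lines through a point\<close>

text \<open>
  Diagonal pairs count as bad because two random points may coincide. The constants are those that
  \<open>54 (A + Q) < 1\<close> provides; as \<open>108 = 2 * 54\<close>, the two sides \<open>ab\<close> and \<open>a'b'\<close> of a random
  quadrilateral together fail with proportion at most \<open>1/54\<close>.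
\<close>

locale near_collineation =
  S: projective_geometry P lines q + T: projective_geometry P' lines' q
  for P :: "'p set" and lines and P' :: "'r set" and lines' and q +
  fixes f :: "'p \<Rightarrow> 'r"
  assumes maps_points: "x \<in> P \<Longrightarrow> f x \<in> P'"
    and inj: "inj_on f P"
    and many_points: "54 * (q + 1) ^ 3 \<le> card P - 1"
    and few_bad_pairs:
      "108 * card {(a, b). a \<in> P \<and> b \<in> P \<and> (a = b \<or> f ` S.line a b \<notin> lines')} \<le> (card P - 1)\<^sup>2"
begin

abbreviation pairs :: "'p \<Rightarrow> ('p \<times> 'p) set" where "pairs \<equiv> S.pairs_through"

abbreviation img :: "'p \<times> 'p \<Rightarrow> 'r set" where
  "img x \<equiv> T.line (f (fst x)) (f (snd x))"

definition bad :: "'p \<Rightarrow> 'p \<Rightarrow> bool" where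
  "bad a b \<longleftrightarrow> a = b \<or> f ` S.line a b \<notin> lines'"

lemma f_eq_iff: "x \<in> P \<Longrightarrow> y \<in> P \<Longrightarrow> f x = f y \<longleftrightarrow> x = y"
  using inj by (meson inj_onD)

lemma card_preimage_le:
  assumes "finite W"
  shows "card ({x. f x \<in> W} \<inter> P) \<le> card W"
  by (rule card_inj_on_le[of f]) (use inj assms in \<open>auto simp: inj_on_def\<close>)

lemma img_line:
  assumes "p \<in> P" "x \<in> pairs p"
  shows "f (fst x) \<in> P'" "f (snd x) \<in> P'" "f (fst x) \<noteq> f (snd x)" "img x \<in> lines'"
    "f (fst x) \<in> img x" "f (snd x) \<in> img x"
proof -
  obtain a b where x: "x = (a, b)" by force
  have *: "a \<in> P" "b \<in> P" "a \<noteq> b"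
    using assms S.pairs_through_points[of p a b] S.pairs_through_iff[of p a b] by (auto simp: x)
  then show "f (fst x) \<in> P'" "f (snd x) \<in> P'" "f (fst x) \<noteq> f (snd x)"
    using maps_points f_eq_iff by (auto simp: x)
  then show "img x \<in> lines'" "f (fst x) \<in> img x" "f (snd x) \<in> img x"
    using T.line by auto
qed

lemma card_pairs_pos: "p \<in> P \<Longrightarrow> 0 < card (pairs p)"
proof -
  assume "p \<in> P"
  moreover have "1 \<le> (q + 1) ^ 3" by simp
  then have "0 < card P - 1" using many_points by linarith
  ultimately show ?thesis using S.order_ge_2 by (simp add: S.card_pairs_through)
qed

lemma few_with_fst_in:
  assumes "p \<in> P" "card (S \<inter> P) \<le> (q + 1) ^ 3"
  shows "54 * card {x \<in> pairs p. fst x \<in> S} \<le> card (pairs p)"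
proof -
  have "54 * card {x \<in> pairs p. fst x \<in> S} \<le> 54 * (q + 1) ^ 3 * (q - 1)"
    using S.card_pairs_through_fst_le[OF assms] by simp
  also have "\<dots> \<le> (card P - 1) * (q - 1)" using many_points by (rule mult_le_mono1)
  finally show ?thesis using assms(1) by (simp add: S.card_pairs_through)
qed

lemma few_with_snd_in:
  assumes "p \<in> P" "card (S \<inter> P) \<le> (q + 1) ^ 3"
  shows "54 * card {x \<in> pairs p. snd x \<in> S} \<le> card (pairs p)"
proof -
  have "54 * card {x \<in> pairs p. snd x \<in> S} \<le> 54 * (q + 1) ^ 3 * (q - 1)"
    using S.card_pairs_through_snd_le[OF assms] by simp
  also have "\<dots> \<le> (card P - 1) * (q - 1)" using many_points by (rule mult_le_mono1)
  finally show ?thesis using assms(1) by (simp add: S.card_pairs_through)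
qed

lemma few_in_small_set:
  assumes "p \<in> P" "finite W" "card W \<le> (q + 1) ^ 3"
  shows "54 * card {x \<in> pairs p. f (fst x) \<in> W} \<le> card (pairs p)"
    "54 * card {x \<in> pairs p. f (snd x) \<in> W} \<le> card (pairs p)"
  using few_with_fst_in[of p "{x. f x \<in> W}"] few_with_snd_in[of p "{x. f x \<in> W}"]
    card_preimage_le[OF assms(2)] assms(1,3) by simp_all

text \<open>
  Veblen's axiom is used twice: in the source, where the lines \<open>aa'\<close> and \<open>bb'\<close> meet in \<open>p\<close>, to find a
  common point \<open>c\<close> of \<open>ab\<close> and \<open>a'b'\<close>; and in the target, where the images of these two lines meet in
  \<open>f c\<close>, to go back.
\<close>

lemma img_meet:
  assumes "p \<in> P" "(a, a') \<in> pairs p" "(b, b') \<in> pairs p" "\<not> bad a b" "\<not> bad a' b'"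
  shows "img (a, a') \<inter> img (b, b') \<noteq> {}"
proof -
  have pts: "a \<in> P" "a' \<in> P" "b \<in> P" "b' \<in> P"
    using S.pairs_through_points assms by blast+
  have "S.col a a' p" "S.col b b' p"
    using assms(1-3) by (auto simp: S.pairs_through_iff collinear_def)
  from S.Veblen[OF this] obtain c where c: "S.col a b c" "S.col a' b' c" by blast
  have im: "T.col (f u) (f v) (f c)" if "u \<in> P" "v \<in> P" "\<not> bad u v" "S.col u v c" for u v
  proof -
    have "u \<noteq> v" "f ` S.line u v \<in> lines'" using that(3) by (auto simp: bad_def)
    moreover have "c \<in> S.line u v"
      using S.col_iff_mem_line that calculation by blast
    ultimately show ?thesis
      using S.line[OF that(1,2)] unfolding collinear_def by blast
  qed
  from T.Veblen[OF im im, of a b a' b'] obtain y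
    where y: "T.col (f a) (f a') y" "T.col (f b) (f b') y" using pts assms c by blast
  then show ?thesis
    using img_line[OF assms(1,2)] img_line[OF assms(1,3)] T.col_iff_mem_line by auto
qed

text \<open>
  Two pairs whose image lines do not meet have a bad side \<open>ab\<close> or \<open>a'b'\<close>. Each bad pair \<open>(a, b)\<close> extends to
  \<open>(q - 1)\<^sup>2\<close> choices of \<open>a'\<close> and \<open>b'\<close>, and exchanging the entries of both pairs turns one event
  into the other.
\<close>

lemma few_nonmeeting:
  assumes p: "p \<in> P"
  shows "54 * card {(x, y). x \<in> pairs p \<and> y \<in> pairs p \<and> img x \<inter> img y = {}} \<le> card (pairs p) * card (pairs p)"
proof -
  let ?D = "{(a, b). a \<in> P \<and> b \<in> P \<and> bad a b}"
  let ?R = "\<lambda>a. S.line p a - {p, a}"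
  have finD: "finite ?D"
    by (rule finite_subset[of _ "P \<times> P"]) (use S.finite_points in auto)
  let ?N = "{(x, y). x \<in> pairs p \<and> y \<in> pairs p \<and> img x \<inter> img y = {}}"
  let ?E1 = "{(x, y). x \<in> pairs p \<and> y \<in> pairs p \<and> bad (fst x) (fst y)}"
  let ?E2 = "{(x, y). x \<in> pairs p \<and> y \<in> pairs p \<and> bad (snd x) (snd y)}"
  have fin: "finite (pairs p \<times> pairs p)" using S.finite_pairs_through p by blast
  have finE: "finite ?E1" "finite ?E2"
    by (rule finite_subset[OF _ fin]; auto)+
  have sub: "?N \<subseteq> ?E1 \<union> ?E2" using img_meet[OF p] by force
  have E1: "card ?E1 \<le> card ?D * ((q - 1) * (q - 1))"
  proof -
    define D0 where "D0 = {(a, b). a \<in> P - {p} \<and> b \<in> P - {p} \<and> bad a b}"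
    have D0: "D0 \<subseteq> ?D" by (auto simp: D0_def)
    have finD0: "finite D0" by (rule finite_subset[OF D0 finD])
    have R: "finite (?R (fst d) \<times> ?R (snd d))"
      "card (?R (fst d) \<times> ?R (snd d)) = (q - 1) * (q - 1)" if "d \<in> D0" for d
    proof -
      have "fst d \<in> P" "snd d \<in> P" "fst d \<noteq> p" "snd d \<noteq> p" using that by (auto simp: D0_def)
      then show "finite (?R (fst d) \<times> ?R (snd d))"
        "card (?R (fst d) \<times> ?R (snd d)) = (q - 1) * (q - 1)"
        using S.card_rest_of_line[OF p] S.finite_line[OF S.line_in_lines[OF p]]
        by (simp_all add: card_cartesian_product)
    qed
    have "card ?E1 \<le> card (SIGMA d:D0. ?R (fst d) \<times> ?R (snd d))"
    proof (rule card_inj_on_le[of "\<lambda>((a, a'), (b, b')). ((a, b), (a', b'))"])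
      show "finite (SIGMA d:D0. ?R (fst d) \<times> ?R (snd d))"
        using finD0 R(1) by (rule finite_SigmaI)
    qed (auto simp: inj_on_def S.pairs_through_def D0_def)
    also have "\<dots> = card D0 * ((q - 1) * (q - 1))"
      using finD0 R by (subst card_SigmaI) simp_all
    also have "\<dots> \<le> card ?D * ((q - 1) * (q - 1))"
      using card_mono[OF finD D0] by (rule mult_le_mono1)
    finally show ?thesis .
  qed
  have "card ?E2 = card ?E1"
  proof (rule bij_betw_same_card[of "map_prod prod.swap prod.swap"])
    show "bij_betw (map_prod prod.swap prod.swap) ?E2 ?E1"
      by (rule bij_betw_byWitness[where f' = "map_prod prod.swap prod.swap"])
        (auto simp add: S.pairs_through_swap[OF p] simp del: swap_simp)
  qed
  then have "card ?N \<le> 2 * (card ?D * ((q - 1) * (q - 1)))"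
    using card_mono[OF finite_UnI[OF finE] sub] card_Un_le[of ?E1 ?E2] E1 by linarith
  then have "54 * card ?N \<le> (108 * card ?D) * ((q - 1) * (q - 1))" by (simp add: mult_ac)
  also have "\<dots> \<le> (card P - 1)\<^sup>2 * ((q - 1) * (q - 1))"
    using few_bad_pairs unfolding bad_def by (rule mult_le_mono1)
  also have "\<dots> = card (pairs p) * card (pairs p)"
    using p by (simp add: S.card_pairs_through power2_eq_square mult_ac)
  finally show ?thesis .
qed

text \<open>
  \<open>K\<close> meets \<open>L\<close> and \<open>M\<close> in different points, as their only common point \<open>r\<close> is not on \<open>K\<close>. The union on
  the right is the plane of \<open>L\<close> and \<open>M\<close>; in this form its size is at most \<open>(q + 1)\<^sup>3\<close>.
\<close>

lemma third_line_in_plane: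
  assumes "L \<in> lines'" "M \<in> lines'" "L \<noteq> M" "r \<in> L" "r \<in> M"
    and "K \<in> lines'" "K \<inter> L \<noteq> {}" "K \<inter> M \<noteq> {}" "r \<notin> K"
  shows "K \<subseteq> (\<Union>(s, t)\<in>{(s, t). s \<in> L \<and> t \<in> M \<and> s \<noteq> t}. T.line s t)"
proof -
  obtain s t where st: "s \<in> K" "s \<in> L" "t \<in> K" "t \<in> M" using assms by blast
  have "s \<noteq> t" using T.lines_meet_once[OF assms(1-3)] st assms by blast
  then show ?thesis using T.line_eqI[OF assms(6), of s t] st by blast
qed

text \<open>
  Averaging gives two pairs \<open>x0\<close>, \<open>y0\<close> whose image lines are distinct, meet in a point \<open>r\<close>, and both meet almost
  all other image lines. An image line that meets both of them and misses \<open>r\<close> lies in their plane, which is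
  rare because \<open>f\<close> is injective.
\<close>

lemma centre_exists:
  assumes p: "p \<in> P"
  obtains r where "r \<in> P'" "10 * card {x \<in> pairs p. r \<notin> img x} \<le> card (pairs p)"
proof -
  note fin = S.finite_pairs_through[OF p]
  define m where "m x = card {y \<in> pairs p. img x \<inter> img y = {}}" for x
  have total: "(\<Sum>x\<in>pairs p. 54 * m x) \<le> card (pairs p) * card (pairs p)"
    using few_nonmeeting[OF p] card_pairs_eq_sum[OF fin fin, of "\<lambda>x y. img x \<inter> img y = {}"]
    by (simp add: m_def sum_distrib_left[symmetric])
  have "pairs p \<noteq> {}" using card_pairs_pos[OF p] by auto
  from averaging[OF fin this total] obtain x0
    where x0: "x0 \<in> pairs p" "54 * m x0 \<le> card (pairs p)" .
  note L0 = img_line[OF p x0(1)]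
  \<comment> \<open>Partners of \<open>x0\<close> that determine a candidate centre; only \<open>2/54\<close> of all pairs are lost.\<close>
  define Y where "Y = {y \<in> pairs p. img x0 \<inter> img y \<noteq> {} \<and> img y \<noteq> img x0}"
  have "pairs p \<subseteq> Y \<union> {y \<in> pairs p. img x0 \<inter> img y = {}} \<union> {y \<in> pairs p. f (fst y) \<in> img x0}"
    using img_line(5)[OF p] unfolding Y_def by fastforce
  then have "card (pairs p) \<le> card (Y \<union> {y \<in> pairs p. img x0 \<inter> img y = {}} \<union> {y \<in> pairs p. f (fst y) \<in> img x0})"
    by (rule card_mono[rotated]) (use fin in \<open>auto simp: Y_def\<close>)
  also have "\<dots> \<le> card Y + m x0 + card {y \<in> pairs p. f (fst y) \<in> img x0}"
    unfolding m_def by (meson add_le_mono1 card_Un_le order_trans)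
  finally have Y: "52 * card (pairs p) \<le> 54 * card Y"
    using x0(2) few_in_small_set(1)[OF p T.finite_line[OF L0(4)] T.card_line_le_cube[OF L0(4)]] by linarith
  have Ysub: "Y \<subseteq> pairs p" and finY: "finite Y" using fin by (auto simp: Y_def)
  have "Y \<noteq> {}" using Y card_pairs_pos[OF p] by auto
  have "54 * (\<Sum>y\<in>Y. 52 * m y) = 52 * (\<Sum>y\<in>Y. 54 * m y)" by (simp add: sum_distrib_left)
  also have "\<dots> \<le> 52 * (\<Sum>y\<in>pairs p. 54 * m y)" 
    using sum_mono2[OF fin Ysub, of "\<lambda>y. 54 * m y"] by simp
  also have "\<dots> \<le> card (pairs p) * (52 * card (pairs p))" using total by simp
  also have "\<dots> \<le> card (pairs p) * (54 * card Y)" using Y by (rule mult_le_mono2)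
  finally have "(\<Sum>y\<in>Y. 52 * m y) \<le> card (pairs p) * card Y" by simp
  from averaging[OF finY \<open>Y \<noteq> {}\<close> this] obtain y0
    where y0: "y0 \<in> Y" "52 * m y0 \<le> card (pairs p)" .
  have y0pairs: "y0 \<in> pairs p" using y0 Ysub by blast
  note L1 = img_line[OF p y0pairs]
  obtain r where r: "r \<in> img x0" "r \<in> img y0" using y0(1) unfolding Y_def by blast
  have ne: "img x0 \<noteq> img y0" using y0(1) by (auto simp: Y_def)
  let ?I = "{(s, t). s \<in> img x0 \<and> t \<in> img y0 \<and> s \<noteq> t}"
  \<comment> \<open>the plane of the two lines\<close>
  define W where "W = (\<Union>(s, t)\<in>?I. T.line s t)"
  have I: "?I \<subseteq> img x0 \<times> img y0" "finite (img x0 \<times> img y0)"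
    using T.finite_line L0(4) L1(4) by auto
  have linesI: "(case i of (s, t) \<Rightarrow> T.line s t) \<in> lines'" if "i \<in> ?I" for i
  proof -
    have "fst i \<in> P'" "snd i \<in> P'" "fst i \<noteq> snd i"
      using that T.line_subset[OF L0(4)] T.line_subset[OF L1(4)] by auto
    then show ?thesis using T.line_in_lines by (simp add: split_beta)
  qed
  have "card W \<le> card ?I * (q + 1)"
    unfolding W_def by (rule T.card_union_lines_le[OF finite_subset[OF I] linesI])
  also have "\<dots> \<le> ((q + 1) * (q + 1)) * (q + 1)"
    using card_mono[OF I(2,1)] T.card_line[OF L0(4)] T.card_line[OF L1(4)]
    by (intro mult_le_mono1) (simp add: card_cartesian_product)
  finally have cardW: "card W \<le> (q + 1) ^ 3" by (simp add: power3_eq_cube)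
  have finW: "finite W" unfolding W_def
    by (rule finite_UN_I[OF finite_subset[OF I]]) (use T.finite_line[OF linesI] in simp)
  have "{x \<in> pairs p. r \<notin> img x} \<subseteq> {y \<in> pairs p. img x0 \<inter> img y = {}} \<union> {y \<in> pairs p. img y0 \<inter> img y = {}}
      \<union> {x \<in> pairs p. f (fst x) \<in> W}"
  proof
    fix z assume z: "z \<in> {x \<in> pairs p. r \<notin> img x}"
    note Lz = img_line[of p z]
    show "z \<in> {y \<in> pairs p. img x0 \<inter> img y = {}} \<union> {y \<in> pairs p. img y0 \<inter> img y = {}}
      \<union> {x \<in> pairs p. f (fst x) \<in> W}"
      using third_line_in_plane[OF L0(4) L1(4) ne r, of "img z"] z Lz p
      unfolding W_def by blast
  qed
  then have "card {x \<in> pairs p. r \<notin> img x} \<le> card ({y \<in> pairs p. img x0 \<inter> img y = {}}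
      \<union> {y \<in> pairs p. img y0 \<inter> img y = {}} \<union> {x \<in> pairs p. f (fst x) \<in> W})"
    by (rule card_mono[rotated]) (use fin in auto)
  also have "\<dots> \<le> m x0 + m y0 + card {x \<in> pairs p. f (fst x) \<in> W}"
    unfolding m_def by (meson add_le_mono1 card_Un_le order_trans)
  finally have "10 * card {x \<in> pairs p. r \<notin> img x} \<le> card (pairs p)"
    using x0(2) y0(2) few_in_small_set(1)[OF p finW cardW] by linarith
  moreover have "r \<in> P'" using r L0(4) T.line_subset by blast
  ultimately show ?thesis using that by blast
qed

section \<open>The centres form a collineation\<close>

definition centre :: "'p \<Rightarrow> 'r" where
  "centre p = (SOME r. r \<in> P' \<and> 10 * card {x \<in> pairs p. r \<notin> img x} \<le> card (pairs p))"

lemma centre: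
  assumes "p \<in> P"
  shows centre_point: "centre p \<in> P'"
    and few_miss_centre: "10 * card {x \<in> pairs p. centre p \<notin> img x} \<le> card (pairs p)"
proof -
  have "\<exists>r. r \<in> P' \<and> 10 * card {x \<in> pairs p. r \<notin> img x} \<le> card (pairs p)"
    by (rule centre_exists[OF assms]) blast
  from someI_ex[OF this] show "centre p \<in> P'"
    "10 * card {x \<in> pairs p. centre p \<notin> img x} \<le> card (pairs p)"
    unfolding centre_def by auto
qed

text \<open>
  Suppose that \<open>r\<close> is the centre of both \<open>p\<^sub>1\<close> and \<open>p\<^sub>2\<close>. A pair \<open>(a, b)\<close> at either point whose image line
  passes through \<open>r\<close> has \<open>f b\<close> on the line joining \<open>f a\<close> to \<open>r\<close>; apart from the few pairs with \<open>r\<close> among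
  \<open>f a\<close>, \<open>f b\<close>, this leaves \<open>q - 1\<close> values for \<open>f b\<close>. For \<open>a\<close> off the line \<open>p\<^sub>1 p\<^sub>2\<close> no pair occurs at both points, so there are at
  most \<open>(N - 1) (q - 1)\<close> such pairs altogether, \<open>N\<close> being the number of points. That is the number of all pairs at one of the
  points, whereas more than half of the pairs at each of them have this property.
\<close>

lemma centre_inj: "inj_on centre P"
proof (rule inj_onI, rule ccontr)
  fix p\<^sub>1 p\<^sub>2 assume p: "p\<^sub>1 \<in> P" "p\<^sub>2 \<in> P" and eq: "centre p\<^sub>1 = centre p\<^sub>2" and ne: "p\<^sub>1 \<noteq> p\<^sub>2"
  define r where "r = centre p\<^sub>1"
  define L where "L = S.line p\<^sub>1 p\<^sub>2"
  note L = S.line[OF p ne, folded L_def]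
  have r: "r \<in> P'" "centre p\<^sub>1 = r" "centre p\<^sub>2 = r" using centre_point p eq by (auto simp: r_def)
  \<comment> \<open>The exclusions cost \<open>3/54\<close> and the pairs missing \<open>r\<close> at most \<open>1/10\<close>, which leaves over \<open>45/54\<close>.\<close>
  define G where "G p = {x \<in> pairs p. r \<in> img x \<and> f (fst x) \<noteq> r \<and> f (snd x) \<noteq> r \<and> fst x \<notin> L}" for p
  have G: "45 * card (pairs p) \<le> 54 * card (G p)" if "p \<in> P" "centre p = r" for p
  proof -
    note fin = S.finite_pairs_through[OF that(1)]
    have "pairs p \<subseteq> G p \<union> {x \<in> pairs p. centre p \<notin> img x} \<union> {x \<in> pairs p. f (fst x) \<in> {r}}
        \<union> {x \<in> pairs p. f (snd x) \<in> {r}} \<union> {x \<in> pairs p. fst x \<in> L}" (is "_ \<subseteq> ?U")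
      by (auto simp: G_def that(2))
    then have "card (pairs p) \<le> card ?U"
      by (rule card_mono[rotated]) (use fin in \<open>auto simp: G_def\<close>)
    also have "\<dots> \<le> card (G p) + card {x \<in> pairs p. centre p \<notin> img x}
        + card {x \<in> pairs p. f (fst x) \<in> {r}} + card {x \<in> pairs p. f (snd x) \<in> {r}}
        + card {x \<in> pairs p. fst x \<in> L}"
      by (meson add_le_mono1 card_Un_le order_trans)
    finally show ?thesis
      using few_miss_centre[OF that(1)] few_in_small_set[OF that(1), of "{r}"]
        few_with_fst_in[OF that(1), of L] S.card_line_le_cube[OF L(1)] S.line_subset[OF L(1)]
      by (simp add: Int_absorb2)
  qed
  have sub: "G p \<subseteq> pairs p" and finG: "finite (G p)" if "p \<in> P" for p
    using S.finite_pairs_through[OF that] by (auto simp: G_def)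
  have disj: "G p\<^sub>1 \<inter> G p\<^sub>2 = {}"
  proof (rule ccontr)
    assume "\<not> ?thesis"
    then obtain a b where ab: "(a, b) \<in> pairs p\<^sub>1" "(a, b) \<in> pairs p\<^sub>2" "a \<notin> L" by (auto simp: G_def)
    then obtain K J where "K \<in> lines" "p\<^sub>1 \<in> K" "a \<in> K" "b \<in> K" "J \<in> lines" "p\<^sub>2 \<in> J" "a \<in> J" "b \<in> J" "a \<noteq> b"
      using p by (auto simp: S.pairs_through_iff collinear_def)
    moreover from this have "K = J" using S.lines_meet_once by blast
    ultimately show False using S.line_eqI[of K p\<^sub>1 p\<^sub>2] ne ab(3) L_def by blast
  qed
  define A where "A = {a \<in> P - {p\<^sub>1}. f a \<noteq> r}"
  have lines_r: "finite (T.line (f a) r - {f a, r})" "card (T.line (f a) r - {f a, r}) = q - 1"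
    if "a \<in> A" for a
    using that r T.card_rest_of_line[of "f a" r] T.finite_line[OF T.line_in_lines[of "f a" r]]
      maps_points by (auto simp: A_def)
  have "card (G p\<^sub>1 \<union> G p\<^sub>2) \<le> card (SIGMA a:A. T.line (f a) r - {f a, r})"
  proof (rule card_inj_on_le[of "\<lambda>(a, b). (a, f b)"])
    have snd: "snd x \<in> P" if "x \<in> G p\<^sub>1 \<union> G p\<^sub>2" for x
      using that sub p S.pairs_through_points[of _ "fst x" "snd x"] by auto
    show "inj_on (\<lambda>(a, b). (a, f b)) (G p\<^sub>1 \<union> G p\<^sub>2)"
      using f_eq_iff snd by (force intro: inj_onI)
    show "finite (SIGMA a:A. T.line (f a) r - {f a, r})"
      using lines_r S.finite_points by (intro finite_SigmaI) (auto simp: A_def)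
    show "(\<lambda>(a, b). (a, f b)) ` (G p\<^sub>1 \<union> G p\<^sub>2) \<subseteq> (SIGMA a:A. T.line (f a) r - {f a, r})"
    proof
      fix y assume "y \<in> (\<lambda>(a, b). (a, f b)) ` (G p\<^sub>1 \<union> G p\<^sub>2)"
      then obtain a b where y: "y = (a, f b)" and ab: "(a, b) \<in> G p\<^sub>1 \<union> G p\<^sub>2" by auto
      then obtain p where p': "p \<in> P" "(a, b) \<in> pairs p" "r \<in> img (a, b)" "f a \<noteq> r" "f b \<noteq> r" "a \<notin> L"
        using p by (auto simp: G_def)
      note im = img_line[OF p'(1,2), simplified]
      have "T.line (f a) r = img (a, b)" 
        using T.line_eqI[OF im(4,5), of r] p'(3,4) by simp
      moreover have "a \<in> P" "a \<noteq> p\<^sub>1" using p' L S.pairs_through_points by blast+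
      ultimately show "y \<in> (SIGMA a:A. T.line (f a) r - {f a, r})"
        using y im p' by (auto simp: A_def)
    qed
  qed
  also have "\<dots> = card A * (q - 1)"
    using lines_r S.finite_points by (subst card_SigmaI) (auto simp: A_def)
  also have "\<dots> \<le> (card P - 1) * (q - 1)"
  proof (rule mult_le_mono1)
    have "card A \<le> card (P - {p\<^sub>1})"
      using S.finite_points by (intro card_mono) (auto simp: A_def)
    then show "card A \<le> card P - 1" using p S.finite_points by simp
  qed
  finally have "card (G p\<^sub>1) + card (G p\<^sub>2) \<le> (card P - 1) * (q - 1)"
    using card_Un_disjoint[OF finG finG disj] p by simp
  then show False
    using G[OF p(1) r(2)] G[OF p(2) r(3)] card_pairs_pos[OF p(1)]
      S.card_pairs_through[OF p(1)] S.card_pairs_through[OF p(2)] by linarith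
qed

text \<open>
  A pair \<open>x = (a\<^sub>1, a\<^sub>2)\<close> at \<open>p\<^sub>3\<close> with \<open>a\<^sub>1\<close> off \<open>L\<close> determines a third vertex \<open>t x\<close>. Completion to a
  triangle is injective towards each of the three sides, so each centre is missed by at most a tenth as
  many triangles as there are pairs at a point, and some triangle misses none while \<open>f a\<^sub>1\<close> avoids the plane \<open>W\<close> spanned by the centres.
\<close>

lemma centre_collinear:
  assumes L: "L \<in> lines" "p\<^sub>1 \<in> L" "p\<^sub>2 \<in> L" "p\<^sub>3 \<in> L" "p\<^sub>1 \<noteq> p\<^sub>2" "p\<^sub>1 \<noteq> p\<^sub>3" "p\<^sub>2 \<noteq> p\<^sub>3"
  shows "centre p\<^sub>3 \<in> T.line (centre p\<^sub>1) (centre p\<^sub>2)"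
proof (rule ccontr)
  assume r3: "centre p\<^sub>3 \<notin> T.line (centre p\<^sub>1) (centre p\<^sub>2)"
  have p: "p\<^sub>1 \<in> P" "p\<^sub>2 \<in> P" "p\<^sub>3 \<in> P" using L S.line_subset by blast+
  note r = centre_point[OF p(1)] centre_point[OF p(2)] centre_point[OF p(3)]
  have ne: "centre p\<^sub>1 \<noteq> centre p\<^sub>2" using centre_inj L p by (meson inj_onD)
  note M = T.line[OF r(1,2) ne]
  \<comment> \<open>the plane of the three centres\<close>
  define W where "W = (\<Union>s\<in>T.line (centre p\<^sub>1) (centre p\<^sub>2). T.line s (centre p\<^sub>3))"
  have linesW: "T.line s (centre p\<^sub>3) \<in> lines'" if "s \<in> T.line (centre p\<^sub>1) (centre p\<^sub>2)" for s
    using that r3 T.line_in_lines r T.line_subset[OF M(1)] by blast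
  have "card W \<le> card (T.line (centre p\<^sub>1) (centre p\<^sub>2)) * (q + 1)"
    unfolding W_def by (rule T.card_union_lines_le[OF T.finite_line[OF M(1)] linesW])
  also have "\<dots> = (q + 1) ^ 2" using T.card_line[OF M(1)] by (simp add: power2_eq_square)
  also have "\<dots> \<le> (q + 1) ^ 3" by (rule power_increasing) auto
  finally have cardW: "card W \<le> (q + 1) ^ 3" .
  have finW: "finite W"
    unfolding W_def using T.finite_line M linesW by blast
  define Z where "Z = {x \<in> pairs p\<^sub>3. fst x \<notin> L}"
  have "\<exists>a\<^sub>3. (fst x, a\<^sub>3) \<in> pairs p\<^sub>2 \<and> (snd x, a\<^sub>3) \<in> pairs p\<^sub>1" if "x \<in> Z" for x
    using that S.third_vertex[OF L, of "fst x" "snd x"] by (auto simp: Z_def)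
  then obtain t where t: "\<And>x. x \<in> Z \<Longrightarrow> (fst x, t x) \<in> pairs p\<^sub>2" "\<And>x. x \<in> Z \<Longrightarrow> (snd x, t x) \<in> pairs p\<^sub>1"
    by metis
  note fin = S.finite_pairs_through[OF p(1)] S.finite_pairs_through[OF p(2)] S.finite_pairs_through[OF p(3)]
  have sw: "(b, a) \<in> pairs p" if "(a, b) \<in> pairs p" "p \<in> P" for a b p
    using S.pairs_through_swap[of p "(a, b)"] that by simp
  have Zout: "snd x \<notin> L" if "x \<in> Z" for x
  proof
    assume *: "snd x \<in> L"
    have "(snd x, fst x) \<in> pairs p\<^sub>3" using that sw p by (auto simp: Z_def)
    then have "fst x \<in> S.line p\<^sub>3 (snd x)" "snd x \<noteq> p\<^sub>3" by (auto simp: S.pairs_through_def)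
    then show False using S.line_eqI[of L p\<^sub>3 "snd x"] * L that by (auto simp: Z_def)
  qed
  define B2 where "B2 = {x \<in> Z. centre p\<^sub>2 \<notin> img (fst x, t x)}"
  define B1 where "B1 = {x \<in> Z. centre p\<^sub>1 \<notin> img (snd x, t x)}"
  have "card B2 \<le> card {y \<in> pairs p\<^sub>2. centre p\<^sub>2 \<notin> img y}"
  proof (rule card_inj_on_le[of "\<lambda>x. (fst x, t x)"])
    show "inj_on (\<lambda>x. (fst x, t x)) B2"
    proof (rule inj_onI)
      fix x y assume *: "x \<in> B2" "y \<in> B2" "(fst x, t x) = (fst y, t y)"
      then have Z: "x \<in> Z" "y \<in> Z" by (auto simp: B2_def)
      have "(fst z, snd z) \<in> pairs p\<^sub>3" "(t z, snd z) \<in> pairs p\<^sub>1" "fst z \<notin> L" if "z \<in> Z" for z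
        using that sw[OF t(2)[OF that] p(1)] by (auto simp: Z_def)
      from this[OF Z(1)] this[OF Z(2)] have "snd x = snd y"
        using S.third_vertex_unique[OF L(1,2,4,6), of "fst x" "snd x" "t x" "snd y"] *(3) by simp
      then show "x = y" using * by (auto simp: prod_eq_iff)
    qed
  qed (use t fin in \<open>auto simp: B2_def\<close>)
  moreover have "card B1 \<le> card {y \<in> pairs p\<^sub>1. centre p\<^sub>1 \<notin> img y}"
  proof (rule card_inj_on_le[of "\<lambda>x. (snd x, t x)"])
    show "inj_on (\<lambda>x. (snd x, t x)) B1"
    proof (rule inj_onI)
      fix x y assume *: "x \<in> B1" "y \<in> B1" "(snd x, t x) = (snd y, t y)"
      then have Z: "x \<in> Z" "y \<in> Z" by (auto simp: B1_def)
      have "(snd z, fst z) \<in> pairs p\<^sub>3" "(t z, fst z) \<in> pairs p\<^sub>2" "snd z \<notin> L" if "z \<in> Z" for z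
        using that sw[OF t(1)[OF that] p(2)] sw[of "fst z" "snd z" p\<^sub>3] p(3) Zout
        by (auto simp: Z_def)
      from this[OF Z(1)] this[OF Z(2)] have "fst x = fst y"
        using S.third_vertex_unique[OF L(1,3,4,7), of "snd x" "fst x" "t x" "fst y"] *(3) by simp
      then show "x = y" using * by (auto simp: prod_eq_iff)
    qed
  qed (use t fin in \<open>auto simp: B1_def\<close>)
  moreover have "pairs p\<^sub>3 \<subseteq> B1 \<union> B2 \<union> {x \<in> pairs p\<^sub>3. centre p\<^sub>3 \<notin> img x} \<union> {x \<in> pairs p\<^sub>3. fst x \<in> L}
      \<union> {x \<in> pairs p\<^sub>3. f (fst x) \<in> W}" (is "_ \<subseteq> ?U")
  proof
    fix x assume x: "x \<in> pairs p\<^sub>3"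
    show "x \<in> ?U"
    proof (rule ccontr)
      assume neg: "x \<notin> ?U"
      then have Z: "x \<in> Z" using x by (auto simp: Z_def)
      have on: "centre p\<^sub>3 \<in> img x" "centre p\<^sub>2 \<in> img (fst x, t x)" "centre p\<^sub>1 \<in> img (snd x, t x)"
        using neg x Z by (auto simp: B1_def B2_def)
      note i3 = img_line[OF p(3) x] and i2 = img_line[OF p(2) t(1)[OF Z]]
        and i1 = img_line[OF p(1) t(2)[OF Z]]
      obtain s where "s \<in> T.line (centre p\<^sub>1) (centre p\<^sub>2)" "f (fst x) \<in> T.line s (centre p\<^sub>3)"
        using T.vertex_in_plane_of_points_on_sides[of "f (fst x)" "f (snd x)" "f (t x)"
            "centre p\<^sub>3" "centre p\<^sub>2" "centre p\<^sub>1"] i1 i2 i3 on ne r3 by auto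
      then show False using neg x by (auto simp: W_def)
    qed
  qed
  then have "card (pairs p\<^sub>3) \<le> card ?U"
    by (rule card_mono[rotated]) (use fin in \<open>auto simp: Z_def B1_def B2_def\<close>)
  then have "card (pairs p\<^sub>3) \<le> card B1 + card B2 + card {x \<in> pairs p\<^sub>3. centre p\<^sub>3 \<notin> img x}
      + card {x \<in> pairs p\<^sub>3. fst x \<in> L} + card {x \<in> pairs p\<^sub>3. f (fst x) \<in> W}"
    by (meson add_le_mono1 card_Un_le order_trans)
  moreover have "54 * card {x \<in> pairs p\<^sub>3. fst x \<in> L} \<le> card (pairs p\<^sub>3)"
    using few_with_fst_in[OF p(3), of L] S.card_line_le_cube[OF L(1)] S.line_subset[OF L(1)]
    by (simp add: Int_absorb2)
  ultimately show False
    using few_miss_centre[OF p(1)] few_miss_centre[OF p(2)] few_miss_centre[OF p(3)]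
      few_in_small_set(1)[OF p(3) finW cardW] card_pairs_pos[OF p(3)]
      S.card_pairs_through[OF p(1)] S.card_pairs_through[OF p(2)] S.card_pairs_through[OF p(3)]
    by linarith
qed

text \<open>
  The image of a line lies on a line, and it fills that line because \<open>centre\<close> is injective and
  all lines have \<open>q + 1\<close> points.
\<close>

lemma centre_line:
  assumes L: "L \<in> lines"
  shows "centre ` L \<in> lines'"
proof -
  have LP: "L \<subseteq> P" using L by (rule S.line_subset)
  have "2 \<le> card L" using S.card_line[OF L] S.order_ge_2 by simp
  then obtain A where "A \<subseteq> L" "card A = 2" by (rule obtain_subset_with_card_n)
  then obtain p\<^sub>1 p\<^sub>2 where p: "p\<^sub>1 \<in> L" "p\<^sub>2 \<in> L" "p\<^sub>1 \<noteq> p\<^sub>2"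
    by (auto simp: card_2_iff)
  have "centre p\<^sub>1 \<in> P'" "centre p\<^sub>2 \<in> P'" "centre p\<^sub>1 \<noteq> centre p\<^sub>2"
    using p LP centre_point centre_inj by (auto simp: inj_on_def)
  note M = T.line[OF this]
  have "centre ` L \<subseteq> T.line (centre p\<^sub>1) (centre p\<^sub>2)"
    using centre_collinear[OF L p(1,2) _ p(3)] M by blast
  moreover have "card (centre ` L) = card (T.line (centre p\<^sub>1) (centre p\<^sub>2))"
    using card_image[OF inj_on_subset[OF centre_inj LP]] S.card_line[OF L] T.card_line[OF M(1)] by simp
  ultimately have "centre ` L = T.line (centre p\<^sub>1) (centre p\<^sub>2)"
    using card_subset_eq T.finite_line[OF M(1)] by blast
  then show ?thesis using M by simp
qed

section \<open>Points that are moved\<close>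

text \<open>
  If the line \<open>p a\<close> is good, then its image is the image line of every pair on it and contains \<open>f p\<close>. Should it also
  contain the centre, it must be the line joining \<open>f p\<close> to the centre, which is so for few pairs.
\<close>

lemma moved_point_on_bad_lines:
  assumes p: "p \<in> P" and moved: "f p \<noteq> centre p"
  shows "card P - 1 \<le> 2 * card {a \<in> P. p \<noteq> a \<and> f ` S.line p a \<notin> lines'}"
proof -
  let ?Bad = "{a \<in> P. p \<noteq> a \<and> f ` S.line p a \<notin> lines'}"
  note fin = S.finite_pairs_through[OF p]
  note M = T.line[OF maps_points[OF p] centre_point[OF p] moved]
  have "pairs p \<subseteq> {x \<in> pairs p. fst x \<in> ?Bad} \<union> {x \<in> pairs p. centre p \<notin> img x}
      \<union> {x \<in> pairs p. f (fst x) \<in> T.line (f p) (centre p)}" (is "_ \<subseteq> ?U")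
  proof
    fix x assume x: "x \<in> pairs p"
    show "x \<in> ?U"
    proof (rule ccontr)
      assume neg: "x \<notin> ?U"
      have mem: "fst x \<in> P" "fst x \<noteq> p" "snd x \<in> S.line p (fst x)"
        using x by (auto simp: S.pairs_through_def)
      then have good: "f ` S.line p (fst x) \<in> lines'" using neg x by auto
      note i = img_line[OF p x]
      have K: "f p \<in> f ` S.line p (fst x)" "f (fst x) \<in> f ` S.line p (fst x)"
        "f (snd x) \<in> f ` S.line p (fst x)"
        using mem S.line[OF p mem(1)] by auto
      then have "img x = f ` S.line p (fst x)" using T.line_eqI[OF good K(2,3) i(3)] by simp
      moreover have "centre p \<in> img x" using neg x by auto
      ultimately have "T.line (f p) (centre p) = img x" 
        using T.line_eqI[OF i(4), of "f p" "centre p"] K moved by simp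
      then show False using neg x i by auto
    qed
  qed
  then have "card (pairs p) \<le> card ?U"
    by (rule card_mono[rotated]) (use fin in auto)
  also have "\<dots> \<le> card {x \<in> pairs p. fst x \<in> ?Bad} + card {x \<in> pairs p. centre p \<notin> img x}
      + card {x \<in> pairs p. f (fst x) \<in> T.line (f p) (centre p)}"
    by (meson add_le_mono1 card_Un_le order_trans)
  finally have "card (pairs p) \<le> 2 * card {x \<in> pairs p. fst x \<in> ?Bad}"
    using few_miss_centre[OF p]
      few_in_small_set(1)[OF p T.finite_line[OF M(1)] T.card_line_le_cube[OF M(1)]] by linarith
  also have "card {x \<in> pairs p. fst x \<in> ?Bad} = card ?Bad * (q - 1)"
    by (rule S.card_pairs_through_fst_in[OF p]) auto
  finally have "(card P - 1) * (q - 1) \<le> (2 * card ?Bad) * (q - 1)"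
    using S.card_pairs_through[OF p] by (simp only: mult.assoc)
  then show ?thesis using S.order_ge_2 by simp
qed

text \<open>
  Count the incidences of moved points with bad lines. Every line carries equally many ordered pairs
  of distinct points, which turns the count of bad pairs into one of bad lines.
\<close>

lemma card_moved_points:
  "card {p \<in> P. f p \<noteq> centre p} * (card P - 1) * card lines
    \<le> 2 * card {L \<in> lines. f ` L \<notin> lines'} * (card P * (card P - 1))"
proof -
  let ?E = "{p \<in> P. f p \<noteq> centre p}" and ?B = "{L \<in> lines. f ` L \<notin> lines'}"
  have "card ?E * (card P - 1) = (\<Sum>p\<in>?E. card P - 1)" by simp
  also have "\<dots> \<le> (\<Sum>p\<in>?E. 2 * card {a \<in> P. p \<noteq> a \<and> f ` S.line p a \<notin> lines'})"
    by (rule sum_mono) (use moved_point_on_bad_lines in blast)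
  also have "\<dots> \<le> (\<Sum>p\<in>P. 2 * card {a \<in> P. p \<noteq> a \<and> f ` S.line p a \<notin> lines'})"
    by (rule sum_mono2) (use S.finite_points in auto)
  also have "\<dots> = 2 * card {(p, a). p \<in> P \<and> a \<in> P \<and> (p \<noteq> a \<and> f ` S.line p a \<notin> lines')}"
    by (subst card_pairs_eq_sum[OF S.finite_points S.finite_points]) (simp add: sum_distrib_left)
  also have "{(p, a). p \<in> P \<and> a \<in> P \<and> (p \<noteq> a \<and> f ` S.line p a \<notin> lines')} =
      {(p, a). p \<in> P \<and> a \<in> P \<and> p \<noteq> a \<and> S.line p a \<in> ?B}"
    using S.line_in_lines by auto
  also have "card \<dots> = card ?B * ((q + 1) * q)" by (rule S.card_pairs_on_lines) auto
  finally have "card ?E * (card P - 1) * card lines \<le> 2 * card ?B * (card lines * ((q + 1) * q))"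
    by (metis (no_types, lifting) mult.assoc mult.commute mult_le_mono1)
  then show ?thesis by (simp only: S.card_points_and_lines)
qed

end

section \<open>The projective geometry of a finite vector space\<close>

text \<open>
  Over a finite field dimension and cardinality determine each other, so that equality of
  subspaces can be decided by inclusion and counting.
\<close>

locale finite_vector_space = vector_space scale
  for scale :: "'a::{field,finite} \<Rightarrow> 'b::ab_group_add \<Rightarrow> 'b" (infixr "*s" 75) +
  fixes q :: nat
  assumes q_eq_card: "q = card (UNIV :: 'a set)"
    and finite_vectors: "finite (UNIV :: 'b set)"
begin

abbreviation points :: "'b set set" where "points \<equiv> proj_points scale"

abbreviation lines :: "'b set set set" where "lines \<equiv> proj_lines scale"

lemma finite_set_of_vectors: "finite (A :: 'b set)"
  by (rule finite_subset[OF subset_UNIV finite_vectors])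

lemma q_ge_2: "2 \<le> q"
proof -
  have "card {0, 1 :: 'a} \<le> q" unfolding q_eq_card by (rule card_mono) auto
  then show ?thesis by simp
qed

text \<open>
  Adjoining a vector \<open>b\<close> outside the span makes \<open>(k, v) \<mapsto> k *s b + v\<close> a bijection onto the larger span.
\<close>

lemma card_span_independent:
  assumes "independent B"
  shows "card (span B) = q ^ card B"
  using finite_set_of_vectors[of B] assms
proof (induction B rule: finite_induct)
  case (insert b B)
  then have b: "b \<notin> span B" "independent B" by (auto simp: independent_insert)
  have "bij_betw (\<lambda>(k, v). k *s b + v) (UNIV \<times> span B) (span (insert b B))"
  proof (rule bij_betw_imageI)
    show "inj_on (\<lambda>(k, v). k *s b + v) (UNIV \<times> span B)"
    proof (rule inj_onI, clarify)
      fix k v l w assume v: "v \<in> span B" "w \<in> span B" and eq: "k *s b + v = l *s b + w"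
      then have "(k - l) *s b = w - v" by (simp add: scale_left_diff_distrib algebra_simps)
      then have *: "(k - l) *s b \<in> span B" using v span_diff by simp
      have "k = l"
      proof (rule ccontr)
        assume "k \<noteq> l"
        then have "b = inverse (k - l) *s ((k - l) *s b)" by simp
        then show False using span_scale[OF *, of "inverse (k - l)"] b by simp
      qed
      then show "k = l \<and> v = w" using eq by simp
    qed
    show "(\<lambda>(k, v). k *s b + v) ` (UNIV \<times> span B) = span (insert b B)"
    proof (intro set_eqI iffI)
      fix x assume "x \<in> (\<lambda>(k, v). k *s b + v) ` (UNIV \<times> span B)"
      then obtain k v where "x = k *s b + v" "v \<in> span B" by auto
      then have "x - k *s b \<in> span B" by simp
      then show "x \<in> span (insert b B)" by (auto simp: span_insert)
    next
      fix x assume "x \<in> span (insert b B)"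
      then obtain k where "x - k *s b \<in> span B" by (auto simp: span_insert)
      then show "x \<in> (\<lambda>(k, v). k *s b + v) ` (UNIV \<times> span B)"
        by (intro image_eqI[of _ _ "(k, x - k *s b)"]) auto
    qed
  qed
  then have "card (span (insert b B)) = card ((UNIV :: 'a set) \<times> span B)"
    by (rule bij_betw_same_card[symmetric])
  also have "\<dots> = q * q ^ card B"
    using insert.IH[OF b(2)] q_eq_card by (simp only: card_cartesian_product)
  finally show ?case using insert.hyps by simp
qed simp

lemma card_subspace:
  assumes "subspace W"
  shows "card W = q ^ dim W"
proof -
  obtain B where B: "B \<subseteq> W" "independent B" "W \<subseteq> span B" "card B = dim W"
    by (rule basis_exists)
  have "span B = W" using B(1,3) assms by (rule span_subspace)
  then show ?thesis using card_span_independent[OF B(2)] B(4) by simp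
qed

lemma dim_eqI: "subspace W \<Longrightarrow> card W = q ^ k \<Longrightarrow> dim W = k"
  using card_subspace[of W] q_ge_2 by simp

lemma vector_set_eqI:
  fixes V W :: "'b set"
  assumes "V \<subseteq> W" "card V = card W"
  shows "V = W"
  using card_subset_eq[OF finite_set_of_vectors assms] .

lemma card_span_vector: "v \<noteq> 0 \<Longrightarrow> card (span {v}) = q"
  using card_span_independent[of "{v}"] by simp

lemma span_vector_in_points: "v \<noteq> 0 \<Longrightarrow> span {v} \<in> points"
  unfolding proj_points_def using dim_eqI[of "span {v}" 1] card_span_vector[of v] by simp

lemma point_eq_span:
  assumes "p \<in> points" "v \<in> p" "v \<noteq> 0"
  shows "p = span {v}"
proof -
  have p: "subspace p" "card p = q" using assms(1) card_subspace[of p] by (auto simp: proj_points_def)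
  have "span {v} \<subseteq> p" using p assms(2) by (simp add: span_minimal)
  moreover have "card (span {v}) = card p" using card_span_vector[OF assms(3)] p by simp
  ultimately show ?thesis by (rule vector_set_eqI[symmetric])
qed

lemma point_obtain:
  assumes "p \<in> points"
  obtains v where "v \<noteq> 0" "p = span {v}"
proof -
  have p: "card p = q" using assms(1) card_subspace[of p] by (auto simp: proj_points_def)
  have "\<not> p \<subseteq> {0}"
  proof
    assume "p \<subseteq> {0}"
    then have "card p \<le> 1" using card_mono[of "{0}" p] by simp
    then show False using p q_ge_2 by simp
  qed
  then show ?thesis using that point_eq_span[OF assms] by blast
qed

text \<open>
  The points in \<open>W\<close> partition its nonzero vectors into classes of size \<open>q - 1\<close>.
\<close>

lemma card_points_in_subspace:
  assumes W: "subspace W"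
  shows "card {p \<in> points. p \<subseteq> W} * (q - 1) = q ^ dim W - 1"
proof -
  let ?S = "{p \<in> points. p \<subseteq> W}"
  have zero: "0 \<in> p" if "p \<in> points" for p
    using that by (auto simp: proj_points_def subspace_0)
  have finS: "finite ?S"
    by (rule finite_subset[of _ "Pow W"]) (use finite_set_of_vectors in auto)
  have "W - {0} = (\<Union>p\<in>?S. p - {0})"
  proof (intro set_eqI iffI)
    fix v assume v: "v \<in> W - {0}"
    then have "span {v} \<in> ?S" using span_vector_in_points W by (simp add: span_minimal)
    moreover have "v \<in> span {v} - {0}" using v by (simp add: span_base)
    ultimately show "v \<in> (\<Union>p\<in>?S. p - {0})" by blast
  qed blast
  moreover have "card (\<Union>p\<in>?S. p - {0}) = (\<Sum>p\<in>?S. card (p - {0}))"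
  proof (rule card_UN_disjoint[OF finS])
    show "\<forall>p\<in>?S. \<forall>p'\<in>?S. p \<noteq> p' \<longrightarrow> (p - {0}) \<inter> (p' - {0}) = {}"
      using point_eq_span by blast
  qed (use finite_set_of_vectors in blast)
  moreover have "card (p - {0}) = q - 1" if "p \<in> ?S" for p
    using that zero[of p] card_subspace[of p] finite_set_of_vectors[of p]
    by (simp add: proj_points_def)
  moreover have "card (W - {0}) = q ^ dim W - 1"
    using card_subspace[OF W] subspace_0[OF W] finite_set_of_vectors[of W] by simp
  ultimately show ?thesis by simp
qed

lemma card_span_two:
  assumes "u \<noteq> 0" "v \<noteq> 0" "span {u} \<noteq> span {v}"
  shows "card (span {u, v}) = q ^ 2"
proof -
  have "u \<notin> span {v}"
    using assms point_eq_span[OF span_vector_in_points[OF assms(2)], of u] by auto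
  then have "independent {u, v}" "u \<noteq> v"
    using assms by (auto simp: independent_insert span_base)
  then show ?thesis using card_span_independent[of "{u, v}"] by (simp add: power2_eq_square)
qed

lemma dim_span_two:
  assumes "u \<noteq> 0" "v \<noteq> 0" "span {u} \<noteq> span {v}"
  shows "dim (span {u, v}) = 2"
  using dim_eqI[OF subspace_span card_span_two[OF assms]] .

lemma plane_spanned:
  assumes "subspace W" "dim W = 2" "u \<in> W" "v \<in> W" "u \<noteq> 0" "v \<noteq> 0" "span {u} \<noteq> span {v}"
  shows "W = span {u, v}"
proof -
  have "span {u, v} \<subseteq> W" using assms by (simp add: span_minimal)
  moreover have "card (span {u, v}) = card W"
    using card_span_two assms card_subspace by simp
  ultimately show ?thesis using vector_set_eqI by blast
qed

lemma join_exists: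
  assumes "a \<in> points" "b \<in> points" "a \<noteq> b"
  shows "\<exists>!L. L \<in> lines \<and> a \<in> L \<and> b \<in> L"
proof -
  obtain u v where uv: "u \<noteq> 0" "a = span {u}" "v \<noteq> 0" "b = span {v}"
    by (rule point_obtain[OF assms(1)], rule point_obtain[OF assms(2)]) blast
  have "dim (span {u, v}) = 2" using dim_span_two[OF uv(1,3)] uv assms by blast
  then have "{p \<in> points. p \<subseteq> span {u, v}} \<in> lines"
    unfolding proj_lines_def by blast
  moreover have "a \<subseteq> span {u, v}" "b \<subseteq> span {u, v}" using uv by (simp_all add: span_mono)
  moreover have "L = {p \<in> points. p \<subseteq> span {u, v}}" if L: "L \<in> lines" "a \<in> L" "b \<in> L" for L
  proof -
    obtain W where W: "L = {p \<in> points. p \<subseteq> W}" "subspace W" "dim W = 2"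
      using L(1) unfolding proj_lines_def by blast
    have "u \<in> W" "v \<in> W" using W L uv span_base[of u "{u}"] span_base[of v "{v}"] by auto
    then show ?thesis using plane_spanned[OF W(2,3)] uv assms W by metis
  qed
  ultimately show ?thesis
    by (intro ex1I[of _ "{p \<in> points. p \<subseteq> span {u, v}}"]) (use assms in blast)+
qed

lemma lines_subset: "L \<in> lines \<Longrightarrow> L \<subseteq> points"
  unfolding proj_lines_def by blast

lemma card_line: "L \<in> lines \<Longrightarrow> card L = Suc q"
proof -
  assume "L \<in> lines"
  then obtain W where W: "L = {p \<in> points. p \<subseteq> W}" "subspace W" "dim W = 2"
    unfolding proj_lines_def by blast
  obtain k where k: "q = Suc (Suc k)" using q_ge_2 by (metis add_2_eq_Suc le_Suc_ex)
  have "card L * (q - 1) = q ^ 2 - 1" using card_points_in_subspace[OF W(2)] W by simp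
  also have "\<dots> = Suc q * (q - 1)" unfolding k by (simp add: power2_eq_square)
  finally show ?thesis using q_ge_2 by (simp only: mult_cancel2) simp
qed

lemma collinear_self_right:
  assumes "L \<in> lines" "a \<in> L" "b \<in> points"
  shows "collinear lines a b b"
  using assms join_exists[of a b] lines_subset unfolding collinear_def by (cases "a = b") blast+

lemma collinear_span:
  assumes "L \<in> lines" "a \<in> L" "a = span {u}" "b = span {v}" "u \<noteq> 0" "v \<noteq> 0"
    and "w \<in> span {u, v}" "w \<noteq> 0"
  shows "collinear lines a b (span {w})"
proof (cases "a = b")
  case True
  then show ?thesis
    using collinear_self_right[OF assms(1,2) span_vector_in_points[OF assms(8)]]
    unfolding collinear_def by blast
next
  case False
  then have "dim (span {u, v}) = 2" using dim_span_two[OF assms(5,6)] assms by blast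
  then have "{p \<in> points. p \<subseteq> span {u, v}} \<in> lines" (is "?L \<in> _")
    unfolding proj_lines_def by blast
  moreover have "a \<in> ?L \<and> b \<in> ?L \<and> span {w} \<in> ?L"
    using assms span_vector_in_points by (simp add: span_mono span_minimal)
  ultimately show ?thesis unfolding collinear_def by (rule rev_bexI)
qed

lemma collinear_coordinates:
  assumes "collinear lines (span {u}) (span {v}) (span {x})" "u \<noteq> 0" "v \<noteq> 0" "x \<noteq> 0"
    and "span {u} \<noteq> span {x}"
  obtains s t where "v = s *s u + t *s x"
proof -
  obtain W where W: "subspace W" "dim W = 2" "span {u} \<subseteq> W" "span {v} \<subseteq> W" "span {x} \<subseteq> W"
    using assms(1) unfolding collinear_def proj_lines_def by auto
  then have "u \<in> W" "v \<in> W" "x \<in> W"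
    using span_base[of u "{u}"] span_base[of v "{v}"] span_base[of x "{x}"] by auto
  then have "v \<in> span {u, x}" using plane_spanned[OF W(1,2)] assms by metis
  then obtain s t where "v - s *s u = t *s x"
    by (auto simp: span_insert[of u] span_singleton)
  then show ?thesis using that[of s t] by (simp add: algebra_simps)
qed

text \<open>
  With \<open>\<xi>\<close> spanning the common point, write \<open>\<beta> = s \<alpha> + t \<xi>\<close> and \<open>\<delta> = s' \<gamma> + t' \<xi>\<close>. Eliminating \<open>\<xi>\<close> gives
  the vector \<open>t' \<beta> - t \<delta> = t' s \<alpha> - t s' \<gamma>\<close> in both planes, which spans the wanted point.
\<close>

lemma Veblen:
  assumes abx: "collinear lines a b x" and cdx: "collinear lines c d x"
  shows "\<exists>y. collinear lines a c y \<and> collinear lines b d y"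
proof -
  obtain L M where L: "L \<in> lines" "a \<in> L" "b \<in> L" "x \<in> L" and M: "M \<in> lines" "c \<in> M" "d \<in> M" "x \<in> M"
    using assms unfolding collinear_def by blast
  have pts: "a \<in> points" "b \<in> points" "c \<in> points" "d \<in> points" "x \<in> points"
    using L M lines_subset by blast+
  note self = collinear_self_right[OF L(1,2) pts(3)] collinear_self_right[OF M(1,2) pts(1)]
    collinear_self_right[OF L(1,3) pts(4)] collinear_self_right[OF M(1,3) pts(2)]
  \<comment> \<open>In each degenerate case one of the given points is a common point of \<open>ac\<close> and \<open>bd\<close>.\<close>
  consider "a = b" | "c = d" | "a = x" | "c = x" | "b = d"
    | "a \<noteq> b" "c \<noteq> d" "a \<noteq> x" "c \<noteq> x" "b \<noteq> d" by blast
  then show ?thesis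
  proof cases
    case 1
    then show ?thesis using self(2,4) collinear_perms(1) by metis
  next
    case 2
    then show ?thesis using self(1,3) by metis
  next
    case 3
    then show ?thesis using self(3) cdx collinear_perms by metis
  next
    case 4
    then show ?thesis using self(4) abx collinear_perms by metis
  next
    case 5
    have "collinear lines a c a" "collinear lines b b a"
      using self(2) L collinear_perms(1) unfolding collinear_def by blast+
    then show ?thesis using 5 by blast
  next
    case 6
    obtain \<alpha> \<beta> \<gamma> \<delta> \<xi> where nz: "\<alpha> \<noteq> 0" "\<beta> \<noteq> 0" "\<gamma> \<noteq> 0" "\<delta> \<noteq> 0" "\<xi> \<noteq> 0"
      and sp: "a = span {\<alpha>}" "b = span {\<beta>}" "c = span {\<gamma>}" "d = span {\<delta>}" "x = span {\<xi>}"
      by (rule point_obtain[OF pts(1)], rule point_obtain[OF pts(2)], rule point_obtain[OF pts(3)],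
          rule point_obtain[OF pts(4)], rule point_obtain[OF pts(5)]) blast
    obtain s t where \<beta>: "\<beta> = s *s \<alpha> + t *s \<xi>"
      using collinear_coordinates[of \<alpha> \<beta> \<xi>] abx nz 6 unfolding sp by blast
    obtain s' t' where \<delta>: "\<delta> = s' *s \<gamma> + t' *s \<xi>"
      using collinear_coordinates[of \<gamma> \<delta> \<xi>] cdx nz 6 unfolding sp by blast
    define \<eta> where "\<eta> = t' *s \<beta> - t *s \<delta>"
    have \<eta>: "\<eta> = (t' * s) *s \<alpha> - (t * s') *s \<gamma>"
      unfolding \<eta>_def \<beta> \<delta> by (simp add: scale_right_distrib mult.commute)
    have same_point: "span {u} = span {v}" if "u \<noteq> 0" "v \<noteq> 0" "u = k *s v" for u v k
      using that point_eq_span[OF span_vector_in_points[of v], of u] span_scale[OF span_base, of v "{v}" k]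
      by simp
    \<comment> \<open>a vanishing coefficient would make \<open>b = a\<close> or \<open>d = c\<close>\<close>
    have t: "t \<noteq> 0" using same_point[of \<beta> \<alpha> s] \<beta> nz 6 sp by auto
    have t': "t' \<noteq> 0" using same_point[of \<delta> \<gamma> s'] \<delta> nz 6 sp by auto
    have "\<eta> \<noteq> 0"
    proof
      assume "\<eta> = 0"
      then have "inverse t' *s (t' *s \<beta>) = inverse t' *s (t *s \<delta>)" by (simp add: \<eta>_def)
      then have "\<beta> = (inverse t' * t) *s \<delta>" using t' by simp
      then show False using same_point[of \<beta> \<delta>] nz 6 sp by blast
    qed
    moreover have "\<eta> \<in> span {\<alpha>, \<gamma>}"
      unfolding \<eta> by (intro span_diff span_scale span_base) auto
    moreover have "\<eta> \<in> span {\<beta>, \<delta>}"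
      unfolding \<eta>_def by (intro span_diff span_scale span_base) auto
    ultimately show ?thesis
      using collinear_span[OF L(1,2) sp(1,3) nz(1,3)] collinear_span[OF L(1,3) sp(2,4) nz(2,4)] by blast
  qed
qed

sublocale projective_geometry points lines q
proof
  have "finite (Pow (UNIV :: 'b set))" by (simp only: finite_Pow_iff finite_vectors)
  then show "finite points" by (rule rev_finite_subset) blast
qed (use q_ge_2 lines_subset card_line join_exists Veblen in auto)

end

text \<open>
  The dimension of a space without a finite basis is \<open>0\<close> by convention, so a positive value
  provides a finite basis.
\<close>

lemma (in vector_space) finite_vectors_if_dim_pos:
  assumes "finite (UNIV :: 'a set)" "0 < dim (UNIV :: 'b set)"
  shows "finite (UNIV :: 'b set)"
proof -
  obtain B :: "'b set" where B: "UNIV \<subseteq> span B" "card B = dim (UNIV :: 'b set)"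
    by (rule basis_exists)
  then have "finite B" using assms(2) by (simp add: card_ge_0_finite)
  then have "finite (span B)"
  proof (induction B rule: finite_induct)
    case (insert b B)
    have "span (insert b B) \<subseteq> (\<lambda>(k, v). scale k b + v) ` (UNIV \<times> span B)"
    proof
      fix x assume "x \<in> span (insert b B)"
      then obtain k where "x - scale k b \<in> span B" by (auto simp: span_insert)
      then show "x \<in> (\<lambda>(k, v). scale k b + v) ` (UNIV \<times> span B)"
        by (intro image_eqI[of _ _ "(k, x - scale k b)"]) auto
    qed
    then show ?case
      by (rule finite_subset) (intro finite_imageI finite_cartesian_product assms(1) insert.IH)
  qed simp
  then show ?thesis using B(1) by (rule rev_finite_subset)
qed

section \<open>The numerical hypotheses\<close>

lemma bound_A_nonneg:
  assumes "2 \<le> q" "0 < n" "0 < \<epsilon>"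
  shows "0 \<le> bound_A q n \<epsilon>"
proof -
  have "real q ^ 1 \<le> real q ^ (n + 1)" "1 \<le> real q ^ (n + 1)"
    using assms by (intro power_increasing one_le_power; simp)+
  then show ?thesis unfolding bound_A_def using assms
    by (intro add_nonneg_nonneg mult_nonneg_nonneg divide_nonneg_nonneg zero_le_power_int) auto
qed

text \<open>
  Both factors \<open>q - 1\<close> and \<open>R\<close> in the first summand of \<open>B\<close> are at least \<open>1\<close>, whence \<open>B \<ge> 6 (A + Q)\<close>.
\<close>

lemma bound_A_plus_plane_term_small:
  assumes "2 \<le> q" "0 < n" "0 < \<epsilon>" "9 * bound_B q n \<epsilon> < 1"
  shows "54 * (bound_A q n \<epsilon> + (real q)\<^sup>2 * (real q + 1)\<^sup>2 / (real q ^ (n + 1) - real q)) < 1"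
proof -
  define A where "A = bound_A q n \<epsilon>"
  define Q where "Q = (real q)\<^sup>2 * (real q + 1)\<^sup>2 / (real q ^ (n + 1) - real q)"
  define R where "R = (real q ^ (n + 1) - 1) / (real q ^ (n + 1) - real q)"
  have "real q ^ 1 < real q ^ (n + 1)" using assms by (intro power_strict_increasing) auto
  then have qn: "real q < real q ^ (n + 1)" by simp
  then have R: "1 \<le> R" unfolding R_def using assms by (simp add: le_divide_eq)
  have A: "0 \<le> A" unfolding A_def by (rule bound_A_nonneg[OF assms(1-3)])
  have Q: "0 \<le> Q" unfolding Q_def using qn by simp
  have "1 \<le> (real q - 1) * R" using mult_mono[of 1 "real q - 1" 1 R] assms R by simp
  moreover define C where "C = (real q - 1) * R * (2 * \<epsilon> + 2 * A + 2 * Q)"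
  ultimately have "1 * (2 * \<epsilon> + 2 * A + 2 * Q) \<le> C"
    unfolding C_def using A Q assms by (intro mult_right_mono) auto
  moreover have "bound_B q n \<epsilon> = 2 * C + 2 * A + 2 * Q"
    unfolding bound_B_def A_def[symmetric] Q_def[symmetric] R_def[symmetric] C_def
    by (simp only: mult.assoc)
  ultimately show ?thesis using assms(3,4) unfolding A_def[symmetric] Q_def[symmetric] by argo
qed

text \<open>
  In terms of the number \<open>N\<close> of points, \<open>A\<close> is \<open>2 (\<epsilon> + 1/N) (N / (N - 1))\<^sup>2 + (q - 1) / (N - 1)\<close>, and its first summand is
  twice the given bound for \<open>d\<close> divided by \<open>(N - 1)\<^sup>2\<close>, up to replacing \<open>N - 1\<close> by \<open>N\<close> in the
  term with \<open>\<epsilon>\<close>. Likewise \<open>Q = q\<^sup>2 (q + 1)\<^sup>2 / ((q - 1) (N - 1))\<close>, and \<open>(q + 1) (q - 1) \<le> q\<^sup>2\<close>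
  compares it with \<open>(q + 1)\<^sup>3\<close>.
\<close>

lemma counting_hypotheses:
  fixes q n N :: nat and d :: real
  assumes "2 \<le> q" "0 < n" "0 < \<epsilon>" "9 * bound_B q n \<epsilon> < 1"
    and N: "real N * (real q - 1) = real q ^ (n + 1) - 1"
    and d: "d \<le> real N + \<epsilon> * (real N * (real N - 1))"
  shows "1 < real N" "108 * d \<le> (real N - 1)\<^sup>2" "54 * (real q + 1) ^ 3 \<le> real N - 1"
proof -
  define A where "A = bound_A q n \<epsilon>"
  define Q where "Q = (real q)\<^sup>2 * (real q + 1)\<^sup>2 / (real q ^ (n + 1) - real q)"
  have small: "54 * (A + Q) < 1"
    unfolding A_def Q_def by (rule bound_A_plus_plane_term_small[OF assms(1-4)])
  have "real q ^ 1 < real q ^ (n + 1)" using assms by (intro power_strict_increasing) auto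
  then have qn: "real q < real q ^ (n + 1)" by simp
  have q: "1 \<le> real q - 1" using assms by simp
  have N1: "(real N - 1) * (real q - 1) = real q ^ (n + 1) - real q"
    using N by (simp add: algebra_simps)
  then have "0 < (real N - 1) * (real q - 1)" using qn by simp
  then show N_gt: "1 < real N" using q by (simp add: zero_less_mult_iff)
  have A: "0 \<le> A" unfolding A_def by (rule bound_A_nonneg[OF assms(1-3)])
  have Q: "0 \<le> Q" unfolding Q_def using qn by simp
  have "A = 2 * (\<epsilon> + 1 / real N) * ((real N - 1) / real N) powi (- 2) + (real q - 1) / (real N - 1)"
    using q N_gt unfolding A_def bound_A_def N[symmetric] N1[symmetric]
    by (simp add: power2_eq_square)
  also have "((real N - 1) / real N) powi (- 2) = (real N)\<^sup>2 / (real N - 1)\<^sup>2"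
    by (simp add: power_int_minus power_divide)
  finally have "2 * (\<epsilon> + 1 / real N) * ((real N)\<^sup>2 / (real N - 1)\<^sup>2) \<le> A"
    using q N_gt by simp
  then have "(2 * (\<epsilon> + 1 / real N) * (real N)\<^sup>2) / (real N - 1)\<^sup>2 \<le> A" by simp
  then have "2 * (\<epsilon> + 1 / real N) * (real N)\<^sup>2 \<le> A * (real N - 1)\<^sup>2"
    using N_gt by (subst (asm) pos_divide_le_eq) auto
  moreover have "(\<epsilon> + 1 / real N) * (real N)\<^sup>2 = \<epsilon> * real N * real N + real N"
    using N_gt by (simp add: field_simps power2_eq_square)
  moreover have "0 \<le> \<epsilon> * real N" using assms by simp
  ultimately have "2 * d \<le> A * (real N - 1)\<^sup>2" using d by (simp add: algebra_simps)
  moreover have "54 * A * (real N - 1)\<^sup>2 \<le> 1 * (real N - 1)\<^sup>2"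
    using small Q by (intro mult_right_mono) auto
  ultimately show "108 * d \<le> (real N - 1)\<^sup>2" by linarith
  have "(real q + 1) * (real q - 1) \<le> (real q)\<^sup>2" by (simp add: algebra_simps power2_eq_square)
  then have "(real q + 1)\<^sup>2 * ((real q + 1) * (real q - 1)) \<le> (real q + 1)\<^sup>2 * (real q)\<^sup>2"
    by (rule mult_left_mono) simp
  also have "\<dots> = Q * ((real N - 1) * (real q - 1))"
    unfolding Q_def N1 using qn by (auto simp del: power_Suc)
  finally have "(real q + 1) ^ 3 * (real q - 1) \<le> Q * (real N - 1) * (real q - 1)"
    by (simp add: power3_eq_cube power2_eq_square mult.assoc)
  then have "54 * (real q + 1) ^ 3 \<le> 54 * (Q * (real N - 1))" using q by simp
  also have "\<dots> = (54 * Q) * (real N - 1)" by (simp only: mult.assoc)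
  also have "\<dots> \<le> 1 * (real N - 1)"
    using small A N_gt by (intro mult_right_mono) auto
  finally show "54 * (real q + 1) ^ 3 \<le> real N - 1" by simp
qed

section \<open>The approximate fundamental theorem\<close>

theorem theorem2p3p1:
  fixes scale1 :: "'a::{field,finite} \<Rightarrow> 'b::ab_group_add \<Rightarrow> 'b"
    and scale2 :: "'a \<Rightarrow> 'c::ab_group_add \<Rightarrow> 'c"
    and q n :: nat
    and f :: "'b set \<Rightarrow> 'c set"
    and \<epsilon> :: real
  assumes "vector_space scale1" and "vector_space scale2"
    and "q = card (UNIV :: 'a set)"
    and "n > 3"
    and "vector_space.dim scale1 (UNIV :: 'b set) = n + 1"
    and "vector_space.dim scale2 (UNIV :: 'c set) = n + 1"
    and "f ` proj_points scale1 \<subseteq> proj_points scale2"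
    and "inj_on f (proj_points scale1)"
    and "\<epsilon> > 0"
    and "proportion (proj_lines scale1)
           (\<lambda>L. f ` L \<in> proj_lines scale2) \<ge> 1 - \<epsilon>"
    and "bound_A q n \<epsilon>
           + 2 * ((real q)^2 * (real q + 1)^2 / (real q ^ (n + 1) - 1)) < 1 / 2"
    and "9 * bound_B q n \<epsilon> + real q powi (- int n + 3) < 1"
  shows "\<exists>f' :: 'b set \<Rightarrow> 'c set.
           f' ` proj_points scale1 \<subseteq> proj_points scale2
         \<and> inj_on f' (proj_points scale1)
         \<and> (\<forall>L \<in> proj_lines scale1. f' ` L \<in> proj_lines scale2)
         \<and> proportion (proj_points scale1) (\<lambda>p. f p = f' p)
             \<ge> 1 - 2 * \<epsilon> - 2 * bound_A q n \<epsilon>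
               - 2 * ((real q)^2 * (real q + 1)^2 / (real q ^ (n + 1) - real q))"
proof -
  interpret V1: vector_space scale1 by (rule assms(1))
  interpret V2: vector_space scale2 by (rule assms(2))
  interpret S: finite_vector_space scale1 q
    by unfold_locales (use assms(3,5) V1.finite_vectors_if_dim_pos in simp_all)
  interpret T: finite_vector_space scale2 q
    by unfold_locales (use assms(3,6) V2.finite_vectors_if_dim_pos in simp_all)
  let ?P = "proj_points scale1" and ?Ls = "proj_lines scale1" and ?Ls' = "proj_lines scale2"
  define N where "N = card ?P"
  define badlines where "badlines = {L \<in> ?Ls. f ` L \<notin> ?Ls'}"
  define A where "A = bound_A q n \<epsilon>"
  define Q where "Q = (real q)\<^sup>2 * (real q + 1)\<^sup>2 / (real q ^ (n + 1) - real q)"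
  have q: "2 \<le> q" by (rule S.q_ge_2)
  have B: "9 * bound_B q n \<epsilon> < 1"
  proof -
    have "0 \<le> real q powi (- int n + 3)" by (simp add: zero_le_power_int)
    then show ?thesis using assms(12) by linarith
  qed
  have "real q ^ 1 < real q ^ (n + 1)" using q assms(4) by (intro power_strict_increasing) auto
  then have Q: "0 \<le> Q" unfolding Q_def by simp
  have A: "0 \<le> A" unfolding A_def using bound_A_nonneg q assms(4,9) by simp
  have "N * (q - 1) = q ^ (n + 1) - 1"
    using S.card_points_in_subspace[OF V1.subspace_UNIV] assms(5) by (simp add: N_def)
  then have "real (N * (q - 1)) = real (q ^ (n + 1) - 1)" by (rule arg_cong)
  then have N: "real N * (real q - 1) = real q ^ (n + 1) - 1"
    using q by (simp add: of_nat_diff)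
  have N_gt: "1 < real N"
    by (rule counting_hypotheses(1)[OF q _ assms(9) B N order_refl]) (use assms(4) in simp)
  have linecount: "real N * (real N - 1) = real (card ?Ls) * (real (q + 1) * real q)"
  proof -
    have "real (N * (N - 1)) = real (card ?Ls * ((q + 1) * q))"
      using S.card_points_and_lines by (simp only: N_def)
    then show ?thesis using N_gt by (simp add: of_nat_diff algebra_simps)
  qed
  have lines_pos: "0 < real (card ?Ls)"
    using linecount N_gt by (auto intro!: Nat.gr0I)
  have fin: "finite ?Ls" using lines_pos by (simp add: card_ge_0_finite)
  have bad: "real (card badlines) \<le> \<epsilon> * real (card ?Ls)"
  proof -
    have "{L \<in> ?Ls. f ` L \<in> ?Ls'} = ?Ls - badlines" by (auto simp: badlines_def)
    moreover have sub: "badlines \<subseteq> ?Ls" by (auto simp: badlines_def)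
    ultimately have "card {L \<in> ?Ls. f ` L \<in> ?Ls'} = card ?Ls - card badlines"
      using fin by (simp add: card_Diff_subset finite_subset)
    moreover have "card badlines \<le> card ?Ls" using sub fin by (rule card_mono[rotated])
    ultimately have "real (card {L \<in> ?Ls. f ` L \<in> ?Ls'}) = real (card ?Ls) - real (card badlines)"
      by (simp add: of_nat_diff)
    then have "1 - \<epsilon> \<le> (real (card ?Ls) - real (card badlines)) / real (card ?Ls)"
      using assms(10) unfolding proportion_def by simp
    then show ?thesis using lines_pos by (simp add: le_divide_eq algebra_simps)
  qed
  define D where "D = {(a, b). a \<in> ?P \<and> b \<in> ?P \<and> (a = b \<or> f ` S.line a b \<notin> ?Ls')}"
  have D: "real (card D) \<le> real N + \<epsilon> * (real N * (real N - 1))"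
  proof -
    let ?D' = "{(a, b). a \<in> ?P \<and> b \<in> ?P \<and> a \<noteq> b \<and> S.line a b \<in> badlines}"
    have "D = (\<lambda>a. (a, a)) ` ?P \<union> ?D'"
      using S.line_in_lines by (auto simp: D_def badlines_def)
    then have "card D \<le> card ((\<lambda>a. (a, a)) ` ?P) + card ?D'" by (simp only: card_Un_le)
    also have "\<dots> \<le> N + card badlines * ((q + 1) * q)"
      using S.card_pairs_on_lines[of badlines] card_image_le[OF S.finite_points, of "\<lambda>a. (a, a)"]
      by (auto simp: badlines_def N_def)
    finally have "real (card D) \<le> real N + real (card badlines) * (real (q + 1) * real q)"
      by (metis of_nat_add of_nat_le_iff of_nat_mult)
    also have "\<dots> \<le> real N + \<epsilon> * real (card ?Ls) * (real (q + 1) * real q)"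
      using bad by (intro add_left_mono mult_right_mono) auto
    finally show ?thesis using linecount by (simp add: mult.assoc)
  qed
  have n: "0 < n" using assms(4) by simp
  note hyps = counting_hypotheses(2,3)[OF q n assms(9) B N D]
  interpret near_collineation ?P ?Ls "proj_points scale2" ?Ls' q f
  proof
    show "f x \<in> proj_points scale2" if "x \<in> ?P" for x using that assms(7) by blast
    show "inj_on f ?P" by (rule assms(8))
    have "real (54 * (q + 1) ^ 3) \<le> real (N - 1)"
      using hyps(2) N_gt by (simp add: of_nat_diff add.commute)
    then show "54 * (q + 1) ^ 3 \<le> card ?P - 1" unfolding N_def by (simp only: of_nat_le_iff)
    have "real (108 * card D) \<le> real ((N - 1)\<^sup>2)" using hyps(1) N_gt by (simp add: of_nat_diff)
    then show "108 * card {(a, b). a \<in> ?P \<and> b \<in> ?P \<and> (a = b \<or> f ` S.line a b \<notin> ?Ls')} \<le> (card ?P - 1)\<^sup>2"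
      unfolding D_def N_def by (simp only: of_nat_le_iff)
  qed
  have moved: "real (card {p \<in> ?P. f p \<noteq> centre p}) \<le> 2 * \<epsilon> * real N"
  proof -
    let ?E = "card {p \<in> ?P. f p \<noteq> centre p}"
    have "real (?E * (N - 1) * card ?Ls) \<le> real (2 * card badlines * (N * (N - 1)))"
      using card_moved_points unfolding N_def badlines_def by (simp only: of_nat_le_iff)
    then have "(real ?E * real (card ?Ls)) * (real N - 1)
        \<le> (2 * real (card badlines) * real N) * (real N - 1)"
      using N_gt by (simp add: of_nat_diff mult_ac)
    then have "real ?E * real (card ?Ls) \<le> 2 * real (card badlines) * real N"
      using N_gt by (simp only: mult_le_cancel_right_pos diff_gt_0_iff_gt)
    also have "\<dots> \<le> 2 * (\<epsilon> * real (card ?Ls)) * real N"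
      using bad by (intro mult_right_mono mult_left_mono) auto
    finally have "real ?E * real (card ?Ls) \<le> (2 * \<epsilon> * real N) * real (card ?Ls)"
      by (simp add: mult_ac)
    then show ?thesis using lines_pos by (simp only: mult_le_cancel_right_pos)
  qed
  have "1 - 2 * \<epsilon> \<le> proportion ?P (\<lambda>p. f p = centre p)"
  proof -
    have "{p \<in> ?P. f p = centre p} = ?P - {p \<in> ?P. f p \<noteq> centre p}" by blast
    then have "card {p \<in> ?P. f p = centre p} = N - card {p \<in> ?P. f p \<noteq> centre p}"
      using S.finite_points by (simp add: card_Diff_subset N_def)
    moreover have "card {p \<in> ?P. f p \<noteq> centre p} \<le> N"
      unfolding N_def using S.finite_points by (intro card_mono) auto
    ultimately have "real (card {p \<in> ?P. f p = centre p}) \<ge> real N - 2 * \<epsilon> * real N"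
      using moved by (simp add: of_nat_diff)
    then show ?thesis
      unfolding proportion_def N_def[symmetric] using N_gt by (simp add: le_divide_eq algebra_simps)
  qed
  then have "1 - 2 * \<epsilon> - 2 * A - 2 * Q \<le> proportion ?P (\<lambda>p. f p = centre p)"
    using A Q by linarith
  then show ?thesis
    unfolding A_def Q_def using centre_point centre_inj centre_line by blast
qed

end
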